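(* Let $\tau:\{0,1\}^*\to\{0,1\}^*$ be the Thue–Morse substitution $\tau(0)=01$, $\tau(1)=10$, and let $(t(n))_{n\in\mathbb{N}_0}$ be the Thue–Morse sequence. For a nonempty word $w=w_0\cdots w_r\in\{0,1\}^*$ let $A_w=\{m\in\mathbb{N} : t(m)=w_0,\dots,t(m+r)=w_r\}$. If $w$ is a prefix of $\tau^k(0)$ or of $\tau^k(1)$ for some $k\in\mathbb{N}$, then $$A_w/2^k\mathbb{N}:=\{n\in\mathbb{N} : 2^kn\in A_w\}$$ is $U^\infty(\Phi)$-uniform for any Følner sequence $\Phi$ in $\mathbb{N}$.
   Context: $\mathbb{N}=\{1,2,\dots\}$. $t(n)$ is the number of digits $1$ in the binary expansion of $n$ modulo $2$; equivalently $t(n)$ is the $n$th letter (indexing from $0$) of the infinite word $\tau^\infty(0)=\lim_k\tau^k(0)$. A word $w_0\cdots w_r$ is a prefix of $u_0\cdots u_s$, $s\ge r$, if $w_i=u_i$ for $0\le i\le r$. A Følner sequence $\Phi=(\Phi_N)$ is a sequence of finite (nonempty) subsets of $\mathbb{N}$ with $|\Phi_N\triangle(\Phi_N+t)|/|\Phi_N|\to0$ for every $t\in\mathbb{N}$; $\mathrm{d}_\Phi(A)=\lim_N|A\cap\Phi_N|/|\Phi_N|$ when it exists. A bounded $\phi:\mathbb{N}\to\mathbb{C}$ admits correlations along $\Phi$ if $\lim_N\frac{1}{|\Phi_N|}\sum_{n\in\Phi_N}\prod_{i=1}^m C^{\epsilon_i}\phi(n+h_i)$ exists for all $m$, $h_i\in\mathbb{N}$,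 $\epsilon_i\in\{0,1\}$ ($C$ = complex conjugation). For such $\phi$: $\|\phi\|_{U^0(\Phi)}=\lim_{N}\frac{1}{|\Phi_N|}\sum_{n\in\Phi_N}\phi(n)$ and $\|\phi\|_{U^{k+1}(\Phi)}^{2^{k+1}}=\lim_{H\to\infty}\frac1H\sum_{h=1}^H\|\Delta_h\phi\|_{U^k(\Phi)}^{2^k}$ with $(\Delta_h\phi)(n)=\phi(n)\overline{\phi(n+h)}$. A set $A\subset\mathbb{N}$ is $U^k(\Phi)$-uniform if $\mathbf{1}_A$ admits correlations along $\Phi$, $\mathrm{d}_\Phi(A)>0$ and $\|\mathbf{1}_A-\mathrm{d}_\Phi(A)\|_{U^k(\Phi)}=0$; it is $U^\infty(\Phi)$-uniform if it is $U^k(\Phi)$-uniform for all $k\in\mathbb{N}$. *)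

theory Defs
  imports "HOL-Analysis.Analysis" "HOL-Library.Sublist" "HOL-Library.Z2"
begin

text \<open>
  Throughout, the positive integers are the elements n \<ge> 1 of type \<^typ>\<open>nat\<close>. A function on the
  positive integers is a function on \<^typ>\<open>nat\<close> whose value at 0 is never inspected.
\<close>

text \<open>
  The alphabet is the two-element type \<^typ>\<open>bit\<close>, words are lists. Since \<^typ>\<open>bit\<close> is the field with
  two elements, \<^const>\<open>of_nat\<close> into it is reduction modulo 2.
\<close>

definition thue_morse :: "nat \<Rightarrow> bit" where
  "thue_morse n = of_nat (card {i. Bit_Operations.bit n i})"

definition tm_letter :: "bit \<Rightarrow> bit list" where
  "tm_letter a = (if a = 0 then [0, 1] else [1, 0])"

definition tm_subst :: "bit list \<Rightarrow> bit list" where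
  "tm_subst w = concat (map tm_letter w)"

definition occurrences :: "bit list \<Rightarrow> nat set" where
  "occurrences w = {m. 1 \<le> m \<and> (\<forall>i<length w. thue_morse (m + i) = w ! i)}"

definition quotient_set :: "nat set \<Rightarrow> nat \<Rightarrow> nat set" where
  "quotient_set A q = {n. 1 \<le> n \<and> q * n \<in> A}"

definition folner :: "(nat \<Rightarrow> nat set) \<Rightarrow> bool" where
  "folner \<Phi> \<longleftrightarrow>
     (\<forall>N. finite (\<Phi> N) \<and> \<Phi> N \<noteq> {} \<and> \<Phi> N \<subseteq> {1..}) \<and>
     (\<forall>t\<ge>1. (\<lambda>N. real (card (sym_diff (\<Phi> N) ((\<lambda>n. n + t) ` \<Phi> N))) / real (card (\<Phi> N)))
               \<longlonglongrightarrow> 0)"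

definition average :: "nat set \<Rightarrow> (nat \<Rightarrow> complex) \<Rightarrow> complex" where
  "average F \<phi> = (\<Sum>n\<in>F. \<phi> n) / of_nat (card F)"

definition has_density :: "(nat \<Rightarrow> nat set) \<Rightarrow> nat set \<Rightarrow> real \<Rightarrow> bool" where
  "has_density \<Phi> A d \<longleftrightarrow> (\<lambda>N. real (card (A \<inter> \<Phi> N)) / real (card (\<Phi> N))) \<longlonglongrightarrow> d"

definition admits_correlations :: "(nat \<Rightarrow> nat set) \<Rightarrow> (nat \<Rightarrow> complex) \<Rightarrow> bool" where
  "admits_correlations \<Phi> \<phi> \<longleftrightarrow>
     bounded (\<phi> ` {1..}) \<and>
     (\<forall>m\<ge>1. \<forall>h :: nat \<Rightarrow> nat. \<forall>\<epsilon> :: nat \<Rightarrow> nat.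
        (\<forall>i\<in>{1..m}. 1 \<le> h i \<and> \<epsilon> i \<in> {0, 1}) \<longrightarrow>
        convergent (\<lambda>N. average (\<Phi> N) (\<lambda>n. \<Prod>i=1..m. (cnj ^^ \<epsilon> i) (\<phi> (n + h i)))))"

definition mult_diff :: "nat \<Rightarrow> (nat \<Rightarrow> complex) \<Rightarrow> nat \<Rightarrow> complex" where
  "mult_diff h \<phi> n = \<phi> n * cnj (\<phi> (n + h))"

text \<open>
  \<open>has_unorm \<Phi> k \<phi> x\<close>: all the limits in the recursive definition of the U^k(\<Phi>)-norm of \<open>\<phi>\<close>
  exist, and the norm is \<open>x\<close>. For k = 0 this is a complex number; for k > 0 it is the nonnegative
  real 2^k-th root.
\<close>

primrec has_unorm ::
  "(nat \<Rightarrow> nat set) \<Rightarrow> nat \<Rightarrow> (nat \<Rightarrow> complex) \<Rightarrow> complex \<Rightarrow> bool" where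
  "has_unorm \<Phi> 0 \<phi> x \<longleftrightarrow> (\<lambda>N. average (\<Phi> N) \<phi>) \<longlonglongrightarrow> x"
| "has_unorm \<Phi> (Suc k) \<phi> x \<longleftrightarrow>
     x \<in> \<real> \<and> 0 \<le> Re x \<and>
     (\<exists>y. (\<forall>h\<ge>1. has_unorm \<Phi> k (mult_diff h \<phi>) (y h)) \<and>
          (\<lambda>H. (\<Sum>h=1..H. y h ^ 2 ^ k) / of_nat H) \<longlonglongrightarrow> x ^ 2 ^ Suc k)"

lemma has_unorm_unique:
  assumes "has_unorm \<Phi> k \<phi> x" "has_unorm \<Phi> k \<phi> x'"
  shows "x = x'"
  using assms
proof (induction k arbitrary: \<phi> x x')
  case 0
  then show ?case by (auto intro: LIMSEQ_unique)
next
  case (Suc k)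
  from Suc.prems obtain y y' where
    y: "\<And>h. h \<ge> 1 \<Longrightarrow> has_unorm \<Phi> k (mult_diff h \<phi>) (y h)"
       "(\<lambda>H. (\<Sum>h=1..H. y h ^ 2 ^ k) / of_nat H) \<longlonglongrightarrow> x ^ 2 ^ Suc k" and
    y': "\<And>h. h \<ge> 1 \<Longrightarrow> has_unorm \<Phi> k (mult_diff h \<phi>) (y' h)"
       "(\<lambda>H. (\<Sum>h=1..H. y' h ^ 2 ^ k) / of_nat H) \<longlonglongrightarrow> x' ^ 2 ^ Suc k"
    unfolding has_unorm.simps by blast
  have "y h = y' h" if "h \<ge> 1" for h
    using Suc.IH y(1) y'(1) that by blast
  then have "(\<Sum>h=1..H. y h ^ 2 ^ k) = (\<Sum>h=1..H. y' h ^ 2 ^ k)" for H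
    by (intro sum.cong) auto
  with y(2) y'(2) have pow: "x ^ 2 ^ Suc k = x' ^ 2 ^ Suc k"
    using LIMSEQ_unique by (simp only:) blast
  obtain a a' where a: "x = of_real a" "x' = of_real a'" "0 \<le> a" "0 \<le> a'"
    using Suc.prems by (auto elim!: Reals_cases)
  with pow have "a ^ 2 ^ Suc k = a' ^ 2 ^ Suc k"
    by (metis of_real_eq_iff of_real_power)
  with a show ?case
    by (metis power_eq_imp_eq_base zero_less_numeral zero_less_power)
qed

definition U_uniform :: "(nat \<Rightarrow> nat set) \<Rightarrow> nat \<Rightarrow> nat set \<Rightarrow> bool" where
  "U_uniform \<Phi> k A \<longleftrightarrow>
     admits_correlations \<Phi> (indicator A) \<and>
     (\<exists>d. has_density \<Phi> A d \<and> d > 0 \<and>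
          has_unorm \<Phi> k (\<lambda>n. indicator A n - of_real d) 0)"

definition U_infinity_uniform :: "(nat \<Rightarrow> nat set) \<Rightarrow> nat set \<Rightarrow> bool" where
  "U_infinity_uniform \<Phi> A \<longleftrightarrow> (\<forall>k\<ge>1. U_uniform \<Phi> k A)"

end

theory Submission
  imports Defs "HOL-Real_Asymp.Real_Asymp"
begin

text \<open>
  Since \<open>t (2 ^ k n + i) = t n + t i\<close> for \<open>i < 2 ^ k\<close>, the set in question is a level set of \<open>t\<close>, and
  the claim is about the signs \<open>s n = (- 1) ^ t n\<close>. The products of \<open>s\<close> over the vertices of a cube
  \<open>(n, h\<^sub>1, \<dots>, h\<^sub>k)\<close>, with bounded offsets at the vertices, are self-similar: splitting off
  the lowest \<open>l\<close> binary digits of \<open>n, h\<^sub>1, \<dots>, h\<^sub>k\<close> leaves a sign and a cube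
  product of the high parts whose offsets are the carries. Two different low parts produce zero carries,
  with opposite signs if there is an odd number of offsets at each vertex; if that number is even, the
  product with zero offsets is constant. So the sums over dyadic cubes contract, uniformly in the
  position: their normalised oscillation tends to 0, and in the odd case the normalised sums
  themselves do. This yields the existence of all iterated limits, and the vanishing of those for
  \<open>s\<close> itself.
\<close>

section \<open>The signed Thue--Morse sequence\<close>

lemma finite_nat_bits: "finite {i. Bit_Operations.bit (n :: nat) i}"
proof (rule finite_subset)
  show "{i. Bit_Operations.bit n i} \<subseteq> {..<n}"
  proof
    fix i
    assume "i \<in> {i. Bit_Operations.bit n i}"
    then have "2 ^ i \<le> n"
      by (metis bit_nat_def div_less even_zero mem_Collect_eq not_less bit_iff_odd)
    with less_exp[of i] have "i < n"
      by (rule order_less_le_trans)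
    then show "i \<in> {..<n}" by simp
  qed
qed simp

text \<open>The ones of \<open>v\<close> lie below position \<open>l\<close>, those of
  \<open>2 ^ l * u\<close> at or above it; the two sets are disjoint, so their cardinalities
  add.\<close>

lemma thue_morse_shift:
  assumes "v < 2 ^ l"
  shows "thue_morse (2 ^ l * u + v) = thue_morse u + thue_morse v"
proof -
  have v: "i < l" if "Bit_Operations.bit v i" for i
  proof (rule ccontr)
    assume "\<not> i < l"
    then have "v < 2 ^ i"
      using assms by (meson le_less_trans not_less order_less_le_trans one_le_numeral power_increasing)
    with that show False
      by (simp add: bit_iff_odd)
  qed
  have bit: "Bit_Operations.bit (2 ^ l * u + v) i \<longleftrightarrow>
      Bit_Operations.bit v i \<or> l \<le> i \<and> Bit_Operations.bit u (i - l)" for i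
  proof (cases "i < l")
    case True
    then have "(2 :: nat) ^ l = 2 ^ i * (2 * 2 ^ (l - Suc i))"
      by (simp flip: power_add power_Suc)
    then have "2 ^ l * u + v = v + 2 ^ i * (2 * (2 ^ (l - Suc i) * u))"
      by (simp only: ac_simps)
    then have "(2 ^ l * u + v) div 2 ^ i = 2 * (2 ^ (l - Suc i) * u) + v div 2 ^ i"
      by (simp only: div_mult_self2 power_not_zero zero_neq_numeral[symmetric] not_False_eq_True)
    with True show ?thesis
      by (simp add: bit_iff_odd)
  next
    case False
    then have "(2 ^ l * u + v) div 2 ^ i = ((2 ^ l * u + v) div 2 ^ l) div 2 ^ (i - l)"
      by (metis div_mult2_eq le_add_diff_inverse not_less power_add)
    with False assms v show ?thesis
      by (auto simp: bit_iff_odd)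
  qed
  have "{i. Bit_Operations.bit (2 ^ l * u + v) i} =
      {i. Bit_Operations.bit v i} \<union> (\<lambda>i. i + l) ` {i. Bit_Operations.bit u i}"
    unfolding bit by (auto simp: image_iff) (metis le_add_diff_inverse2)
  moreover have "{i. Bit_Operations.bit v i} \<inter> (\<lambda>i. i + l) ` {i. Bit_Operations.bit u i} = {}"
    using v by fastforce
  ultimately have "card {i. Bit_Operations.bit (2 ^ l * u + v) i} =
      card {i. Bit_Operations.bit v i} + card {i. Bit_Operations.bit u i}"
    using finite_nat_bits by (simp add: card_Un_disjoint card_image)
  then show ?thesis
    unfolding thue_morse_def by (simp only: of_nat_add add.commute)
qed

lemma thue_morse_0 [simp]: "thue_morse 0 = 0"
  by (simp add: thue_morse_def)

lemma thue_morse_1 [simp]: "thue_morse 1 = 1" "thue_morse (Suc 0) = 1"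
proof -
  have "{i. Bit_Operations.bit (1::nat) i} = {0}"
    by (auto simp: bit_iff_odd) (metis div_0 div_less even_zero less_Suc0 less_exp not_gr_zero
      One_nat_def one_less_power one_less_numeral_iff semiring_norm(76))
  then show "thue_morse 1 = 1" "thue_morse (Suc 0) = 1"
    by (simp_all add: thue_morse_def)
qed

section \<open>Iterates of the substitution and level sets of the sequence\<close>

lemma tm_subst_append: "tm_subst (xs @ ys) = tm_subst xs @ tm_subst ys"
  by (simp add: tm_subst_def)

text \<open>Appending the binary digit 0 preserves \<open>thue_morse\<close> and appending 1 flips
  it, which is the substitution rule \<open>b\<close> to \<open>[b, b + 1]\<close>. Adding
  \<open>a\<close> in the field with two elements treats both starting letters at once.\<close>

lemma tm_subst_pow:
  "(tm_subst ^^ k) [a] = map (\<lambda>i. a + thue_morse i) [0..<2 ^ k]"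
proof (induction k)
  case 0
  then show ?case by simp
next
  case (Suc k)
  have step: "tm_subst (map (\<lambda>i. a + thue_morse i) [0..<n]) =
      map (\<lambda>i. a + thue_morse i) [0..<2 * n]" for n
  proof (induction n)
    case 0
    then show ?case by (simp add: tm_subst_def)
  next
    case (Suc n)
    have "thue_morse (2 * n) = thue_morse n" "thue_morse (Suc (2 * n)) = thue_morse n + 1"
      using thue_morse_shift[of 0 1 n] thue_morse_shift[of 1 1 n] by simp_all
    moreover have "tm_letter b = [b, b + 1]" for b
      by (cases b) (simp_all add: tm_letter_def)
    ultimately have "map (\<lambda>i. a + thue_morse i) [0..<2 * Suc n] =
        map (\<lambda>i. a + thue_morse i) [0..<2 * n] @ tm_letter (a + thue_morse n)"
      by (simp del: add_bit_eq_xor add: add.assoc)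
    then show ?case
      using Suc by (simp add: tm_subst_append) (simp add: tm_subst_def)
  qed
  show ?case
    using Suc step by simp
qed

text \<open>All positions in \<open>w\<close> are below \<open>2 ^ k\<close>, so the letters read at
  \<open>2 ^ k * n\<close> are those of \<open>w\<close> shifted by the constant
  \<open>thue_morse n + a\<close>. Agreement at position 0 therefore forces agreement
  everywhere.\<close>

lemma quotient_set_occurrences:
  assumes "w \<noteq> []" "prefix w ((tm_subst ^^ k) [a])"
  shows "quotient_set (occurrences w) (2 ^ k) = {n. 1 \<le> n \<and> thue_morse n = a}"
proof -
  have len: "length w \<le> 2 ^ k"
    using prefix_length_le[OF assms(2)] by (simp add: tm_subst_pow)
  have w: "w ! i = a + thue_morse i" if "i < length w" for i
  proof -
    have "w = take (length w) ((tm_subst ^^ k) [a])"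
      using assms(2) by (auto simp: prefix_def)
    then have "w ! i = (tm_subst ^^ k) [a] ! i"
      using that by (metis nth_take)
    with that len show ?thesis
      by (simp add: tm_subst_pow)
  qed
  have "(\<forall>i<length w. thue_morse (2 ^ k * n + i) = w ! i) \<longleftrightarrow> thue_morse n = a" for n
  proof
    assume "\<forall>i<length w. thue_morse (2 ^ k * n + i) = w ! i"
    then have "thue_morse (2 ^ k * n + 0) = a + thue_morse 0"
      using assms(1) w by (metis length_greater_0_conv)
    then show "thue_morse n = a"
      using thue_morse_shift[of 0 k n] by (simp only: thue_morse_0 add_0_right zero_less_power zero_less_numeral)
  next
    assume "thue_morse n = a"
    with w len show "\<forall>i<length w. thue_morse (2 ^ k * n + i) = w ! i"
      by (metis thue_morse_shift order_less_le_trans)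
  qed
  then show ?thesis
    by (auto simp: quotient_set_def occurrences_def)
qed

definition tm_sign :: "nat \<Rightarrow> real" where
  "tm_sign n = (if thue_morse n = 0 then 1 else - 1)"

lemma tm_sign_0 [simp]: "tm_sign 0 = 1"
  by (simp add: tm_sign_def)

lemma abs_tm_sign [simp]: "\<bar>tm_sign n\<bar> = 1"
  by (simp add: tm_sign_def)

text \<open>Here \<open>x\<close> may exceed \<open>2 ^ l\<close>; the quotient
  \<open>x div 2 ^ l\<close> is the carry into the high digits.\<close>

lemma tm_sign_shift: "tm_sign (2 ^ l * u + x) = tm_sign (x mod 2 ^ l) * tm_sign (u + x div 2 ^ l)"
proof -
  have "2 ^ l * u + x = 2 ^ l * (u + x div 2 ^ l) + x mod 2 ^ l"
    by (simp add: algebra_simps)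
  then have "thue_morse (2 ^ l * u + x) = thue_morse (u + x div 2 ^ l) + thue_morse (x mod 2 ^ l)"
    using thue_morse_shift[of "x mod 2 ^ l" l "u + x div 2 ^ l"] by simp
  then show ?thesis
    by (cases "thue_morse (u + x div 2 ^ l)"; cases "thue_morse (x mod 2 ^ l)")
      (simp_all add: tm_sign_def)
qed

lemma tm_sign_power2: "tm_sign (2 ^ l) = - 1"
  using thue_morse_shift[of 0 l 1] by (simp add: tm_sign_def)

section \<open>Iterated Cesaro limits\<close>

definition cesaro :: "(nat \<Rightarrow> real) \<Rightarrow> real \<Rightarrow> bool" where
  "cesaro f z \<longleftrightarrow> (\<lambda>N. (\<Sum>n<N. f n) / real N) \<longlonglongrightarrow> z"

lemma cesaro_cmult: "cesaro f z \<Longrightarrow> cesaro (\<lambda>n. c * f n) (c * z)"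
  unfolding cesaro_def by (drule tendsto_mult_left[of _ _ _ c]) (simp add: sum_distrib_left)

lemma cesaro_add: "cesaro f z \<Longrightarrow> cesaro g z' \<Longrightarrow> cesaro (\<lambda>n. f n + g n) (z + z')"
  unfolding cesaro_def by (drule (1) tendsto_add) (simp add: sum.distrib add_divide_distrib)

lemma cesaro_zero: "cesaro (\<lambda>n. 0) 0"
  by (simp add: cesaro_def)

text \<open>Omitting the term at 0 changes the average by \<open>f 0 / N\<close> and a factor
  tending to 1. This gives invariance under shifts of the base point and the passage to averages
  over \<open>h = 1..H\<close>.\<close>

lemma cesaro_Suc:
  assumes "cesaro f z"
  shows "cesaro (\<lambda>n. f (Suc n)) z"
proof -
  have 1: "(\<lambda>N. (\<Sum>n<Suc N. f n) / real (Suc N)) \<longlonglongrightarrow> z"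
    using assms unfolding cesaro_def by (rule LIMSEQ_Suc)
  have 2: "(\<lambda>N. real (Suc N) / real N) \<longlonglongrightarrow> 1"
    by (rule LIMSEQ_Suc_n_over_n)
  have 3: "(\<lambda>N. f 0 / real N) \<longlonglongrightarrow> 0"
    by (rule lim_const_over_n)
  have "(\<lambda>N. (\<Sum>n<Suc N. f n) / real (Suc N) * (real (Suc N) / real N) - f 0 / real N)
      \<longlonglongrightarrow> z * 1 - 0"
    by (intro tendsto_intros 1 2 3)
  moreover have "(\<Sum>n<Suc N. f n) / real (Suc N) * (real (Suc N) / real N) - f 0 / real N =
      (\<Sum>n<N. f (Suc n)) / real N" for N
    by (simp add: sum.lessThan_Suc_shift add_divide_distrib[symmetric] diff_divide_distrib[symmetric]
        del: sum.lessThan_Suc of_nat_Suc)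
  ultimately show ?thesis
    unfolding cesaro_def by simp
qed

lemma sum_blocks:
  fixes f :: "nat \<Rightarrow> 'a :: comm_monoid_add"
  shows "(\<Sum>n<M * B. f n) = (\<Sum>b<B. \<Sum>j<M. f (M * b + j))"
proof (induction B)
  case (Suc B)
  have "(\<Sum>n<M * Suc B. f n) = (\<Sum>n<M * B. f n) + (\<Sum>n=M * B..<M * B + M. f n)"
    by (simp add: add.commute atLeast0LessThan[symmetric] sum.atLeastLessThan_concat)
  also have "(\<Sum>n=M * B..<M * B + M. f n) = (\<Sum>j<M. f (M * B + j))"
    by (simp add: atLeast0LessThan[symmetric] add.commute
        flip: sum.shift_bounds_nat_ivl[where k="M*B" and m=0, simplified])
  finally show ?case
    using Suc by simp
qed simp

text \<open>Along the lengths \<open>M * Suc B\<close> the averages are means of block averages, and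
  this subsequence has the same limit.\<close>

lemma cesaro_le_blocks:
  assumes "cesaro f z" "M > 0" "\<And>b. (\<Sum>j<M. f (M * b + j)) \<le> \<beta> * real M"
  shows "z \<le> \<beta>"
proof (rule LIMSEQ_le_const2)
  have "strict_mono (\<lambda>B. M * Suc B)"
    using assms(2) by (auto simp: strict_mono_Suc_iff)
  with assms(1) show "(\<lambda>B. (\<Sum>n<M * Suc B. f n) / real (M * Suc B)) \<longlonglongrightarrow> z"
    unfolding cesaro_def by (auto dest: LIMSEQ_subseq_LIMSEQ simp: o_def)
  have "(\<Sum>n<M * Suc B. f n) \<le> (\<Sum>b<Suc B. \<beta> * real M)" for B
    unfolding sum_blocks by (intro sum_mono assms(3))
  then have "(\<Sum>n<M * Suc B. f n) \<le> \<beta> * real (M * Suc B)" for B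
    by (simp add: algebra_simps)
  moreover have "real (M * Suc B) > 0" for B
    using assms(2) by (simp del: of_nat_Suc of_nat_mult)
  ultimately have "(\<Sum>n<M * Suc B. f n) / real (M * Suc B) \<le> \<beta>" for B
    by (simp only: pos_divide_le_eq)
  then show "\<exists>N. \<forall>n\<ge>N. (\<Sum>n<M * Suc n. f n) / real (M * Suc n) \<le> \<beta>"
    by blast
qed

text \<open>This mirrors the recursion of \<open>has_unorm\<close>, with initial segments in place
  of a Folner sequence and without taking roots: the base point is averaged first, the head of the
  edge list last.\<close>

primrec itlim :: "nat \<Rightarrow> (nat list \<Rightarrow> nat \<Rightarrow> real) \<Rightarrow> real \<Rightarrow> bool" where
  "itlim 0 G z \<longleftrightarrow> cesaro (G []) z"
| "itlim (Suc k) G z \<longleftrightarrow> (\<exists>y. (\<forall>h. itlim k (\<lambda>hs. G (h # hs)) (y h)) \<and> cesaro y z)"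

lemma itlim_cmult: "itlim k G z \<Longrightarrow> itlim k (\<lambda>hs n. c * G hs n) (c * z)"
proof (induction k arbitrary: G z)
  case (Suc k)
  then obtain y where "\<forall>h. itlim k (\<lambda>hs. G (h # hs)) (y h)" "cesaro y z"
    by auto
  with Suc.IH show ?case
    by (auto intro!: exI[of _ "\<lambda>h. c * y h"] cesaro_cmult)
qed (simp add: cesaro_cmult)

lemma itlim_add:
  "itlim k G z \<Longrightarrow> itlim k G' z' \<Longrightarrow> itlim k (\<lambda>hs n. G hs n + G' hs n) (z + z')"
proof (induction k arbitrary: G z G' z')
  case (Suc k)
  then obtain y y' where "\<forall>h. itlim k (\<lambda>hs. G (h # hs)) (y h)" "cesaro y z"
    "\<forall>h. itlim k (\<lambda>hs. G' (h # hs)) (y' h)" "cesaro y' z'"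
    by auto
  with Suc.IH show ?case
    by (auto intro!: exI[of _ "\<lambda>h. y h + y' h"] cesaro_add)
qed (simp add: cesaro_add)

lemma itlim_zero: "itlim k (\<lambda>hs n. 0) 0"
  by (induction k) (auto intro: cesaro_zero)

lemma itlim_sum:
  assumes "\<And>i. i \<in> I \<Longrightarrow> itlim k (G i) (z i)"
  shows "itlim k (\<lambda>hs n. \<Sum>i\<in>I. G i hs n) (\<Sum>i\<in>I. z i)"
  using assms
  by (induction I rule: infinite_finite_induct) (simp_all add: itlim_zero itlim_add)

lemma itlim_Suc: "itlim k G z \<Longrightarrow> itlim k (\<lambda>hs n. G hs (Suc n)) z"
proof (induction k arbitrary: G z)
  case (Suc k)
  then show ?case by fastforce
qed (simp add: cesaro_Suc)

lemma itlim_shift: "itlim k G z \<Longrightarrow> itlim k (\<lambda>hs n. G hs (n + i)) z"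
proof (induction i)
  case (Suc i)
  then show ?case
    using itlim_Suc[of k "\<lambda>hs n. G hs (n + i)" z] by simp
qed simp

section \<open>Sums over boxes aligned to a grid\<close>

definition words :: "nat \<Rightarrow> nat \<Rightarrow> nat list set" where
  "words M k = {xs. set xs \<subseteq> {..<M} \<and> length xs = k}"

lemma finite_words [simp]: "finite (words M k)"
  unfolding words_def by (rule finite_lists_length_eq) simp

lemma card_words [simp]: "card (words M k) = M ^ k"
  unfolding words_def by (simp add: card_lists_length_eq)

lemma words_0 [simp]: "words M 0 = {[]}"
  by (auto simp: words_def)

lemma sum_words_Suc:
  "(\<Sum>hs\<in>words M (Suc k). f hs) = (\<Sum>h<M. \<Sum>hs\<in>words M k. f (h # hs))"
proof -
  have "(\<Sum>hs\<in>words M (Suc k). f hs) = (\<Sum>(h, hs)\<in>{..<M} \<times> words M k. f (h # hs))"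
    by (rule sum.reindex_bij_witness[of _ "\<lambda>(h, hs). h # hs" "\<lambda>hs. (hd hs, tl hs)"])
      (auto simp: words_def length_Suc_conv)
  then show ?thesis
    by (simp add: sum.cartesian_product)
qed

definition dilate :: "nat \<Rightarrow> nat list \<Rightarrow> nat list \<Rightarrow> nat list" where
  "dilate M bs hs = map2 (\<lambda>b h. M * b + h) bs hs"

lemma dilate_simps [simp]:
  "dilate M [] [] = []" "dilate M (b # bs) (h # hs) = (M * b + h) # dilate M bs hs"
  by (simp_all add: dilate_def)

text \<open>The box has side \<open>M\<close> in \<open>Suc k\<close> dimensions and corner
  \<open>M\<close> times \<open>(a, bs)\<close>. When \<open>M\<close> is a power of two, base point
  and edges run through all values of their low digits while the high digits stay fixed.\<close>

definition cube_sum :: "nat \<Rightarrow> nat \<Rightarrow> nat \<Rightarrow> nat list \<Rightarrow> (nat list \<Rightarrow> nat \<Rightarrow> real) \<Rightarrow> real" where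
  "cube_sum M k a bs G = (\<Sum>n<M. \<Sum>hs\<in>words M k. G (dilate M bs hs) (M * a + n))"

lemma cube_sum_0: "cube_sum M 0 a [] G = (\<Sum>n<M. G [] (M * a + n))"
  by (simp add: cube_sum_def)

lemma cube_sum_Suc:
  "cube_sum M (Suc k) a (b # bs) G =
    cube_sum M k a bs (\<lambda>hs n. \<Sum>h<M. G ((M * b + h) # hs) n)"
proof -
  have "cube_sum M k a bs (\<lambda>hs n. \<Sum>h<M. G ((M * b + h) # hs) n) =
      (\<Sum>n<M. \<Sum>h<M. \<Sum>hs\<in>words M k. G ((M * b + h) # dilate M bs hs) (M * a + n))"
    unfolding cube_sum_def by (intro sum.cong refl sum.swap)
  then show ?thesis
    by (simp add: cube_sum_def sum_words_Suc)
qed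

lemma cube_sum_diff:
  "cube_sum M k a bs (\<lambda>hs n. G hs n - G' hs n) = cube_sum M k a bs G - cube_sum M k a bs G'"
  by (simp add: cube_sum_def sum_subtractf)

lemma cube_sum_uminus: "cube_sum M k a bs (\<lambda>hs n. - G hs n) = - cube_sum M k a bs G"
  by (simp add: cube_sum_def sum_negf)

text \<open>Although the limits are taken one variable at a time, bounds on whole boxes suffice: a
  block sum over the outermost edge is by linearity an iterated limit of lower depth, so induction
  bounds it uniformly in its position, and \<open>cesaro_le_blocks\<close> handles the last
  limit.\<close>

lemma itlim_le:
  assumes "itlim k G z" "M > 0"
    and "\<And>a bs. length bs = k \<Longrightarrow> cube_sum M k a bs G \<le> \<beta> * real M ^ Suc k"
  shows "z \<le> \<beta>"
  using assms
proof (induction k arbitrary: G z \<beta>)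
  case 0
  then show ?case
    by (auto simp: cube_sum_0 intro: cesaro_le_blocks)
next
  case (Suc k)
  from Suc.prems(1) obtain y
    where y: "\<And>h. itlim k (\<lambda>hs. G (h # hs)) (y h)" "cesaro y z"
    by auto
  have "(\<Sum>h<M. y (M * b + h)) \<le> \<beta> * real M" for b
  proof (rule Suc.IH[OF _ Suc.prems(2)])
    show "itlim k (\<lambda>hs n. \<Sum>h<M. G ((M * b + h) # hs) n) (\<Sum>h<M. y (M * b + h))"
      by (intro itlim_sum y)
    show "cube_sum M k a bs (\<lambda>hs n. \<Sum>h<M. G ((M * b + h) # hs) n) \<le> \<beta> * real M * real M ^ Suc k"
      if "length bs = k" for a bs
      using Suc.prems(3)[of "b # bs" a] that by (simp add: cube_sum_Suc mult.assoc)
  qed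
  with y(2) Suc.prems(2) show ?case
    by (rule cesaro_le_blocks)
qed

lemma itlim_abs_le:
  assumes "itlim k G z" "M > 0"
    and "\<And>a bs. length bs = k \<Longrightarrow> \<bar>cube_sum M k a bs G\<bar> \<le> \<beta> * real M ^ Suc k"
  shows "\<bar>z\<bar> \<le> \<beta>"
proof -
  have "z \<le> \<beta>"
    using abs_le_D1[OF assms(3)] by (rule itlim_le[OF assms(1,2)])
  moreover have "- z \<le> \<beta>"
  proof (rule itlim_le[OF _ assms(2)])
    show "itlim k (\<lambda>hs n. - G hs n) (- z)"
      using itlim_cmult[OF assms(1), of "- 1"] by simp
    show "cube_sum M k a bs (\<lambda>hs n. - G hs n) \<le> \<beta> * real M ^ Suc k" if "length bs = k" for a bs
      using abs_le_D2[OF assms(3)[OF that]] by (simp add: cube_sum_uminus)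
  qed
  ultimately show ?thesis
    by simp
qed

text \<open>The double sum is the sum of the first \<open>m\<close> partial sums of \<open>2 y\<close>, up to \<open>m y 0\<close>, so a
  negative mean would make it negative.\<close>

lemma cesaro_nonneg:
  assumes "cesaro y z" and pos: "\<And>m. 0 \<le> (\<Sum>i<m. \<Sum>j<m. y (if i \<le> j then j - i else i - j))"
  shows "0 \<le> z"
proof (rule ccontr)
  assume "\<not> 0 \<le> z"
  then have z: "z < 0" by simp
  define S where "S n = (\<Sum>h<n. y h)" for n
  have dbl: "(\<Sum>i<m. \<Sum>j<m. y (if i \<le> j then j - i else i - j)) =
      2 * (\<Sum>i<m. S (Suc i)) - real m * y 0" for m
  proof (induction m)
    case (Suc m)
    have 1: "(\<Sum>j<m. y (m - j)) = S (Suc m) - y 0"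
    proof -
      have "(\<Sum>j<m. y (m - j)) = (\<Sum>j<m. y (Suc j))"
        by (rule sum.reindex_bij_witness[of _ "\<lambda>j. m - Suc j" "\<lambda>j. m - Suc j"])
          (auto simp: Suc_diff_Suc)
      then show ?thesis
        unfolding S_def sum.lessThan_Suc_shift by simp
    qed
    have 2: "(\<Sum>i<m. y (if i \<le> m then m - i else i - m)) = (\<Sum>i<m. y (m - i))"
      "(\<Sum>i<m. y (if m \<le> i then i - m else m - i)) = (\<Sum>i<m. y (m - i))"
      by (auto intro!: sum.cong)
    show ?case
      using Suc by (simp add: sum.distrib 1 2 algebra_simps)
  qed simp
  have "eventually (\<lambda>N. S N / real N < z / 2) sequentially"
    using assms(1) z unfolding cesaro_def S_def by (intro order_tendstoD) auto
  then obtain N0 where N0: "\<And>N. N \<ge> N0 \<Longrightarrow> S N / real N < z / 2"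
    by (auto simp: eventually_sequentially)
  \<comment> \<open>This absorbs the finitely many \<open>i < N0\<close> for which
    \<open>S (Suc i)\<close> need not lie below its asymptotic bound.\<close>
  define C where "C = (\<Sum>i<N0. \<bar>S (Suc i)\<bar> + \<bar>z\<bar> * real (Suc i))"
  have S: "S (Suc i) \<le> z / 2 * real (Suc i)
      + (if i < N0 then \<bar>S (Suc i)\<bar> + \<bar>z\<bar> * real (Suc i) else 0)" for i
  proof (cases "i < N0")
    case True
    have "z * real (Suc i) \<le> 0"
      using z by (intro mult_nonpos_nonneg) auto
    with z have "- (z / 2 * real (Suc i)) \<le> \<bar>z\<bar> * real (Suc i)"
      by (simp del: of_nat_Suc)
    with True show ?thesis
      by simp
  next
    case False
    then show ?thesis
      using N0[of "Suc i"] by (simp add: divide_simps del: of_nat_Suc split: if_splits)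
  qed
  have gauss: "(\<Sum>i<m. real (Suc i)) \<ge> (real m)\<^sup>2 / 2" for m
    by (induction m) (auto simp: power2_eq_square field_simps)
  have "0 \<le> 2 * C + z / 2 * (real m)\<^sup>2 + real m * \<bar>y 0\<bar>" for m
  proof -
    have "(\<Sum>i<m. if i < N0 then \<bar>S (Suc i)\<bar> + \<bar>z\<bar> * real (Suc i) else 0) =
        (\<Sum>i\<in>{..<m} \<inter> {..<N0}. \<bar>S (Suc i)\<bar> + \<bar>z\<bar> * real (Suc i))"
      by (simp add: sum.If_cases Int_def)
    also have "\<dots> \<le> C"
      unfolding C_def by (intro sum_mono2) auto
    finally have tail: "(\<Sum>i<m. if i < N0 then \<bar>S (Suc i)\<bar> + \<bar>z\<bar> * real (Suc i) else 0) \<le> C" .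
    have "(\<Sum>i<m. S (Suc i)) \<le> (\<Sum>i<m. z / 2 * real (Suc i)
        + (if i < N0 then \<bar>S (Suc i)\<bar> + \<bar>z\<bar> * real (Suc i) else 0))"
      by (rule sum_mono[OF S])
    also have "\<dots> = z / 2 * (\<Sum>i<m. real (Suc i))
        + (\<Sum>i<m. if i < N0 then \<bar>S (Suc i)\<bar> + \<bar>z\<bar> * real (Suc i) else 0)"
      unfolding sum.distrib sum_distrib_left ..
    also have "\<dots> \<le> z / 2 * (\<Sum>i<m. real (Suc i)) + C"
      using tail by simp
    finally have "(\<Sum>i<m. S (Suc i)) \<le> z / 2 * (\<Sum>i<m. real (Suc i)) + C" .
    also have "\<dots> \<le> z / 2 * ((real m)\<^sup>2 / 2) + C"
      using z gauss[of m] by (intro add_right_mono mult_left_mono_neg) auto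
    finally have "2 * (\<Sum>i<m. S (Suc i)) \<le> z / 2 * (real m)\<^sup>2 + 2 * C"
      by simp
    moreover have "- (real m * y 0) \<le> real m * \<bar>y 0\<bar>"
      using mult_left_mono[of "- y 0" "\<bar>y 0\<bar>" "real m"] by simp
    ultimately show ?thesis
      using pos[of m] unfolding dbl by linarith
  qed
  \<comment> \<open>The quadratic term has the negative coefficient \<open>z / 2\<close> and
    outweighs the linear one.\<close>
  moreover have "filterlim (\<lambda>m. - (2 * C + z / 2 * (real m)\<^sup>2 + real m * \<bar>y 0\<bar>)) at_top sequentially"
    using z by real_asymp
  then have "eventually (\<lambda>m. - (2 * C + z / 2 * (real m)\<^sup>2 + real m * \<bar>y 0\<bar>) > 0) sequentially"
    unfolding filterlim_at_top_dense by blast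
  ultimately show False
    by (metis (no_types, lifting) eventually_sequentially neg_0_less_iff_less not_less order_refl)
qed

section \<open>Cube products of the Thue--Morse sequence\<close>

text \<open>The offsets form a list, not a set: carries may make distinct offsets coincide, and the
  parity of their number has to survive this.\<close>

definition shift_prod :: "nat list \<Rightarrow> nat \<Rightarrow> real" where
  "shift_prod J n = (\<Prod>v\<leftarrow>J. tm_sign (n + v))"

lemma shift_prod_simps [simp]:
  "shift_prod [] n = 1" "shift_prod (v # J) n = tm_sign (n + v) * shift_prod J n"
  by (simp_all add: shift_prod_def)

lemma shift_prod_append: "shift_prod (J @ J') n = shift_prod J n * shift_prod J' n"
  by (simp add: shift_prod_def)

lemma shift_prod_map_add: "shift_prod (map (\<lambda>v. v + h) J) n = shift_prod J (n + h)"
  by (simp add: shift_prod_def o_def ac_simps)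

lemma abs_shift_prod [simp]: "\<bar>shift_prod J n\<bar> = 1"
  by (induction J) (simp_all add: abs_mult)

text \<open>The vertices of the cube spanned by the edges \<open>hs\<close> at \<open>n\<close> are indexed by \<open>w :: bool list\<close>;
  vertex \<open>w\<close> carries the product of the signs over the offsets \<open>r w\<close>.\<close>

primrec cube :: "(bool list \<Rightarrow> nat list) \<Rightarrow> nat list \<Rightarrow> nat \<Rightarrow> real" where
  "cube r [] n = shift_prod (r []) n"
| "cube r (h # hs) n = cube (\<lambda>w. r (False # w)) hs n * cube (\<lambda>w. r (True # w)) hs (n + h)"

lemma abs_cube [simp]: "\<bar>cube r hs n\<bar> = 1"
  by (induction hs arbitrary: r n) (simp_all add: abs_mult)

lemma cube_append: "cube (\<lambda>w. r w @ r' w) hs n = cube r hs n * cube r' hs n"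
  by (induction hs arbitrary: r r' n) (simp_all add: shift_prod_append)

lemma cube_map_add: "cube (\<lambda>w. map (\<lambda>v. v + h) (r w)) hs n = cube r hs (n + h)"
  by (induction hs arbitrary: r n) (simp_all add: shift_prod_map_add ac_simps)

text \<open>Fixing the first edge yields a cube of lower dimension with twice as many offsets.
  Constant offset lists are thus closed under multiplicative differences, and inductions on the
  dimension run over all \<open>J\<close>.\<close>

lemma cube_const_Cons: "cube (\<lambda>w. J) (h # hs) = cube (\<lambda>w. J @ map (\<lambda>v. v + h) J) hs"
  by (rule ext) (simp add: cube_append cube_map_add)

lemma cube_replicate: "cube (\<lambda>w. replicate d 0) hs n = cube (\<lambda>w. [0]) hs n ^ d"
proof (induction hs arbitrary: n)
  case Nil
  then show ?case by (induction d) simp_all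
qed (simp add: power_mult_distrib)

section \<open>Splitting off low digits: signs and carries\<close>

fun vertex :: "bool list \<Rightarrow> nat list \<Rightarrow> nat" where
  "vertex (e # w) (h # hs) = (if e then h else 0) + vertex w hs"
| "vertex _ _ = 0"

lemma vertex_le: "vertex w hs \<le> sum_list hs"
  by (induction w hs rule: vertex.induct) auto

primrec low_sign :: "nat \<Rightarrow> (bool list \<Rightarrow> nat list) \<Rightarrow> nat list \<Rightarrow> nat \<Rightarrow> real" where
  "low_sign l r [] c = (\<Prod>v\<leftarrow>r []. tm_sign ((v + c) mod 2 ^ l))"
| "low_sign l r (y # ys) c =
    low_sign l (\<lambda>w. r (False # w)) ys c * low_sign l (\<lambda>w. r (True # w)) ys (c + y)"

text \<open>Each new offset is the overflow from adding the old offset to the low digits of the base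
  point and of the edges leading to the vertex \<open>w\<close>.\<close>

definition carry :: "nat \<Rightarrow> (bool list \<Rightarrow> nat list) \<Rightarrow> nat list \<Rightarrow> nat \<Rightarrow> bool list \<Rightarrow> nat list" where
  "carry l r ys c w = map (\<lambda>v. (v + c + vertex w ys) div 2 ^ l) (r w)"

lemma cube_dilate:
  assumes "length hs = length ys"
  shows "cube r (dilate (2 ^ l) hs ys) (2 ^ l * n + c) = low_sign l r ys c * cube (carry l r ys c) hs n"
  using assms
proof (induction hs ys arbitrary: r n c rule: list_induct2)
  case Nil
  have "shift_prod J (2 ^ l * n + c) = (\<Prod>v\<leftarrow>J. tm_sign ((v + c) mod 2 ^ l)) *
      shift_prod (map (\<lambda>v. (v + c) div 2 ^ l) J) n" for J
  proof (induction J)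
    case (Cons v J)
    then show ?case
      using tm_sign_shift[of l n "v + c"] by (simp add: ac_simps)
  qed simp
  then show ?case
    by (simp add: carry_def)
next
  case (Cons h hs y ys)
  have "carry l (\<lambda>w. r (False # w)) ys c = (\<lambda>w. carry l r (y # ys) c (False # w))"
    "carry l (\<lambda>w. r (True # w)) ys (c + y) = (\<lambda>w. carry l r (y # ys) c (True # w))"
    by (simp_all add: carry_def fun_eq_iff ac_simps)
  moreover have "2 ^ l * n + c + (2 ^ l * h + y) = 2 ^ l * (n + h) + (c + y)"
    by (simp add: algebra_simps)
  ultimately show ?case
    by (simp only: dilate_simps cube.simps low_sign.simps Cons.IH mult.assoc mult.left_commute)
qed

lemma abs_low_sign [simp]: "\<bar>low_sign l r ys c\<bar> = 1"
proof -
  \<comment> \<open>The list \<open>ys\<close> doubles as the high part because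
    \<open>cube_dilate\<close> asks for one of the same length; both cube products have absolute
    value 1.\<close>
  have "low_sign l r ys c * cube (carry l r ys c) ys 0 = cube r (dilate (2 ^ l) ys ys) c"
    using cube_dilate[of ys ys r l 0 c] by simp
  then show ?thesis
    by (metis abs_cube abs_mult mult.right_neutral)
qed

section \<open>Cubes on which the signs multiply to -1\<close>

lemma cube_add_edges:
  "cube (\<lambda>w. [0]) (replicate (m + k) 1) n = 1"
  if "\<And>n. cube (\<lambda>w. [0]) (replicate k 1) n = 1"
  using that by (induction m arbitrary: n) simp_all

text \<open>Over the two-element field, \<open>(1 + T) ^ 2 ^ j = 1 + T ^ 2 ^ j\<close>.\<close>

lemma cube_two_power_edges:
  "cube (\<lambda>w. [0]) (replicate (2 ^ j + i) 1) n =
    cube (\<lambda>w. [0]) (replicate i 1) n * cube (\<lambda>w. [0]) (replicate i 1) (n + 2 ^ j)"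
proof (induction j arbitrary: i n)
  case (Suc j)
  have sq: "cube r hs n * cube r hs n = 1" for r hs n
    by (metis abs_cube abs_mult_self_eq mult.right_neutral)
  have "2 ^ Suc j + i = 2 ^ j + (2 ^ j + i)" "n + 2 ^ Suc j = n + 2 ^ j + 2 ^ j"
    by simp_all
  then show ?case
    using sq by (simp only: Suc.IH) (simp add: mult.assoc mult.left_commute)
qed simp

text \<open>Otherwise every cube with \<open>k\<close> unit edges would give 1, and so would every
  one with \<open>2 ^ k\<close> unit edges. At 0 the latter equals
  \<open>tm_sign 0 * tm_sign (2 ^ k)\<close>, which is -1.\<close>

lemma cube_eq_minus_one: "\<exists>n hs. length hs = k \<and> cube (\<lambda>w. [0]) hs n = - 1"
proof (rule ccontr)
  assume neg: "\<nexists>n hs. length hs = k \<and> cube (\<lambda>w. [0]) hs n = - 1"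
  have "cube (\<lambda>w. [0]) (replicate k 1) n = 1" for n
    using neg abs_cube[of "\<lambda>w. [0]" "replicate k 1" n]
    by (metis abs_eq_iff' abs_one length_replicate)
  then have "cube (\<lambda>w. [0]) (replicate (2 ^ k - k + k) 1) 0 = 1"
    by (rule cube_add_edges)
  then have "cube (\<lambda>w. [0]) (replicate (2 ^ k + 0) 1) 0 = 1"
    using less_exp[of k] by simp
  then have "tm_sign (2 ^ k) = 1"
    unfolding cube_two_power_edges by simp
  then show False
    by (simp add: tm_sign_power2)
qed

section \<open>Bounded offsets and low parts with zero carries\<close>

definition bounded_offsets :: "nat \<Rightarrow> nat \<Rightarrow> (bool list \<Rightarrow> nat list) \<Rightarrow> bool" where
  "bounded_offsets d K r \<longleftrightarrow> (\<forall>w. length (r w) = d \<and> (\<forall>v\<in>set (r w). v \<le> K))"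

lemma sum_list_words_le: "ys \<in> words (Suc M) k \<Longrightarrow> sum_list ys \<le> k * M"
proof (induction k arbitrary: ys)
  case (Suc k)
  then obtain y ys' where "ys = y # ys'" "y \<le> M" "ys' \<in> words (Suc M) k"
    by (auto simp: words_def length_Suc_conv less_Suc_eq_le)
  with Suc.IH[of ys'] show ?case
    by simp
qed (simp add: words_def)

text \<open>With \<open>M = 2 ^ l - 1\<close>, a low part adds at most \<open>Suc k * M\<close> to
  an offset, and \<open>K + Suc k * M \<le> K * 2 ^ l\<close> once \<open>Suc k \<le> K\<close>. The
  same bound \<open>K\<close> therefore persists under all carries.\<close>

lemma bounded_offsets_carry:
  assumes "bounded_offsets d K r" "Suc k \<le> K" "c < 2 ^ l" "ys \<in> words (2 ^ l) k"
  shows "bounded_offsets d K (carry l r ys c)"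
proof -
  obtain M where M: "2 ^ l = Suc M"
    by (metis gr0_implies_Suc zero_less_numeral zero_less_power)
  have "(v + c + vertex w ys) div 2 ^ l \<le> K" if "v \<in> set (r w)" for v w
  proof -
    have "vertex w ys \<le> k * M"
      using vertex_le[of w ys] sum_list_words_le[of ys M k] assms(4) M by simp
    moreover have "c \<le> M" "v \<le> K"
      using assms(1,3) M that by (auto simp: bounded_offsets_def)
    ultimately have "v + c + vertex w ys \<le> K + Suc k * M"
      by simp
    also have "\<dots> \<le> K + K * M"
      using assms(2) by (intro add_left_mono mult_right_mono) auto
    also have "\<dots> = 2 ^ l * K"
      using M by simp
    finally have "(v + c + vertex w ys) div 2 ^ l \<le> 2 ^ l * K div 2 ^ l"
      by (rule div_le_mono)
    then show ?thesis
      by simp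
  qed
  with assms(1) show ?thesis
    by (auto simp: bounded_offsets_def carry_def)
qed

lemma carry_eq_zero:
  assumes "bounded_offsets d K r" "K + c + sum_list ys < 2 ^ l"
  shows "carry l r ys c = (\<lambda>w. replicate d 0)"
proof
  fix w
  have "(v + c + vertex w ys) div 2 ^ l = 0" if "v \<in> set (r w)" for v
  proof -
    have "v + c + vertex w ys \<le> K + c + sum_list ys"
      using that assms(1) vertex_le[of w ys] by (auto simp: bounded_offsets_def intro!: add_mono)
    with assms(2) show ?thesis
      by (intro div_less) simp
  qed
  then have "carry l r ys c w = map (\<lambda>v. 0) (r w)"
    by (simp add: carry_def)
  with assms(1) show "carry l r ys c w = replicate d 0"
    by (simp add: bounded_offsets_def map_replicate_const)
qed

lemma cube_zero_zero: "cube (\<lambda>w. replicate d 0) (replicate k 0) 0 = 1"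
proof -
  have "cube (\<lambda>w. [0]) (replicate k 0) 0 = 1"
    by (induction k) simp_all
  then show ?thesis
    by (simp add: cube_replicate)
qed

lemma dilate_zeros: "dilate M (replicate (length ys) 0) ys = ys"
  by (induction ys) simp_all

lemma dilate_zeros_right: "dilate M ys (replicate (length ys) 0) = map ((*) M) ys"
  by (induction ys) simp_all

text \<open>The second low part is a multiple \<open>2 ^ q\<close> of a cube on which the signs multiply to \<open>- 1\<close>; with
  \<open>K < 2 ^ q\<close>, the offsets occupy the digits below \<open>q\<close> and do not interact with it.\<close>

lemma opposite_low_parts:
  "\<exists>l c ys. c < 2 ^ l \<and> ys \<in> words (2 ^ l) k \<and> (c, ys) \<noteq> (0, replicate k 0) \<and>
    (\<forall>r. bounded_offsets d K r \<longrightarrow>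
      carry l r (replicate k 0) 0 = (\<lambda>w. replicate d 0) \<and>
      carry l r ys c = (\<lambda>w. replicate d 0) \<and>
      low_sign l r ys c = (- 1) ^ d * low_sign l r (replicate k 0) 0)"
proof -
  obtain z zs where z: "length zs = k" "cube (\<lambda>w. [0]) zs z = - 1"
    using cube_eq_minus_one by blast
  define q where "q = K"
  have q: "K < 2 ^ q"
    by (simp add: q_def less_exp)
  define c where "c = 2 ^ q * z"
  define ys where "ys = map ((*) (2 ^ q)) zs"
  define l where "l = K + c + sum_list ys"
  have l: "K + c + sum_list ys < 2 ^ l"
    by (simp add: l_def less_exp)
  have len: "length ys = k"
    by (simp add: ys_def z)
  \<comment> \<open>With zero high part and no overflow, \<open>cube_dilate\<close> identifies the
    low sign with the cube product itself.\<close>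
  have low: "low_sign l r us b = cube r us b"
    if "bounded_offsets d K r" "length us = k" "K + b + sum_list us < 2 ^ l" for r us b
    using cube_dilate[of "replicate k 0" us r l 0 b] that cube_zero_zero[of d k]
      dilate_zeros[of "2 ^ l" us] carry_eq_zero[OF that(1,3)] by simp
  have scaled: "cube r (map ((*) (2 ^ q)) us) (2 ^ q * b) =
      low_sign q r (replicate k 0) 0 * cube (\<lambda>w. [0]) us b ^ d"
    if "bounded_offsets d K r" "length us = k" for r us b
    using cube_dilate[of us "replicate k 0" r q b 0] that q
      dilate_zeros_right[of "2 ^ q" us] carry_eq_zero[OF that(1), of 0 "replicate k 0" q]
    by (simp add: cube_replicate sum_list_replicate)
  have zeros: "cube (\<lambda>w. [0]) (replicate k 0) 0 = 1"
    using cube_zero_zero[of 1 k] by simp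
  show ?thesis
  proof (rule exI[of _ l], rule exI[of _ c], rule exI[of _ ys], intro conjI allI impI)
    show "c < 2 ^ l"
      using l by simp
    show "ys \<in> words (2 ^ l) k"
      using l len member_le_sum_list[of _ ys] by (fastforce simp: words_def)
    show "(c, ys) \<noteq> (0, replicate k 0)"
    proof
      assume "(c, ys) = (0, replicate k 0)"
      then have "z = 0" "map ((*) (2 ^ q)) zs = replicate k 0"
        by (simp_all add: c_def ys_def)
      moreover from this(2) have "\<forall>y\<in>set (map ((*) (2 ^ q)) zs). y = 0"
        by (simp add: set_replicate_conv_if)
      then have "zs = replicate k 0"
        using z(1) by (intro replicate_eqI) auto
      ultimately show False
        using z(2) zeros by simp
    qed
    fix r
    assume r: "bounded_offsets d K r"
    show "carry l r (replicate k 0) 0 = (\<lambda>w. replicate d 0)" "carry l r ys c = (\<lambda>w. replicate d 0)"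
      using l by (intro carry_eq_zero[OF r]; simp add: sum_list_replicate)+
    have "low_sign l r ys c = low_sign q r (replicate k 0) 0 * (- 1) ^ d"
      using low[OF r len l] scaled[OF r z(1), of z] z(2) by (simp add: ys_def c_def)
    moreover have "low_sign l r (replicate k 0) 0 = low_sign q r (replicate k 0) 0"
      using low[OF r, of "replicate k 0" 0] scaled[OF r, of "replicate k 0" 0] l zeros
      by (simp add: sum_list_replicate)
    ultimately show "low_sign l r ys c = (- 1) ^ d * low_sign l r (replicate k 0) 0"
      by simp
  qed
qed

section \<open>Decay over dyadic cubes\<close>

lemma sum_words_mult:
  "(\<Sum>hs\<in>words (P * Q) k. f hs) = (\<Sum>ys\<in>words P k. \<Sum>zs\<in>words Q k. f (dilate P zs ys))"
proof (induction k arbitrary: f)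
  case (Suc k)
  have "(\<Sum>hs\<in>words (P * Q) (Suc k). f hs) =
      (\<Sum>z<Q. \<Sum>c<P. \<Sum>ys\<in>words P k. \<Sum>zs\<in>words Q k. f ((P * z + c) # dilate P zs ys))"
    by (simp add: sum_words_Suc sum_blocks Suc)
  also have "\<dots> = (\<Sum>c<P. \<Sum>z<Q. \<Sum>ys\<in>words P k. \<Sum>zs\<in>words Q k. f ((P * z + c) # dilate P zs ys))"
    by (rule sum.swap)
  also have "\<dots> = (\<Sum>c<P. \<Sum>ys\<in>words P k. \<Sum>z<Q. \<Sum>zs\<in>words Q k. f ((P * z + c) # dilate P zs ys))"
    by (intro sum.cong refl sum.swap)
  finally show ?case
    by (simp add: sum_words_Suc)
qed simp

lemma dilate_dilate:
  assumes "length bs = length zs" "length zs = length ys"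
  shows "dilate (P * Q) bs (dilate P zs ys) = dilate P (dilate Q bs zs) ys"
  using assms by (induction bs zs ys rule: list_induct3) (simp_all add: algebra_simps)

text \<open>The low \<open>l\<close> digits are summed outermost; each choice leaves a box of side
  \<open>2 ^ m\<close> for the offsets after the carry. The position \<open>(a, bs)\<close> is
  unchanged, so later bounds are uniform in it.\<close>

lemma cube_sum_split:
  assumes "length bs = k"
  shows "cube_sum (2 ^ (m + l)) k a bs (cube r) =
    (\<Sum>(c, ys)\<in>{..<2 ^ l} \<times> words (2 ^ l) k.
      low_sign l r ys c * cube_sum (2 ^ m) k a bs (cube (carry l r ys c)))"
proof -
  let ?P = "2 ^ l :: nat" and ?Q = "2 ^ m :: nat"
  have point: "cube r (dilate (?P * ?Q) bs (dilate ?P zs ys)) (?P * ?Q * a + (?P * z + c)) =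
      low_sign l r ys c * cube (carry l r ys c) (dilate ?Q bs zs) (?Q * a + z)"
    if "ys \<in> words ?P k" "zs \<in> words ?Q k" for ys zs z c
  proof -
    have len: "length zs = k" "length ys = k" "length (dilate ?Q bs zs) = k"
      using that assms by (simp_all add: words_def dilate_def)
    have "?P * ?Q * a + (?P * z + c) = ?P * (?Q * a + z) + c"
      by (simp add: algebra_simps)
    with len assms show ?thesis
      by (simp only: dilate_dilate cube_dilate)
  qed
  have "cube_sum (2 ^ (m + l)) k a bs (cube r) =
      (\<Sum>n<?P * ?Q. \<Sum>hs\<in>words (?P * ?Q) k. cube r (dilate (?P * ?Q) bs hs) (?P * ?Q * a + n))"
    by (simp add: cube_sum_def power_add mult.commute)
  also have "\<dots> = (\<Sum>z<?Q. \<Sum>c<?P. \<Sum>ys\<in>words ?P k. \<Sum>zs\<in>words ?Q k.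
      low_sign l r ys c * cube (carry l r ys c) (dilate ?Q bs zs) (?Q * a + z))"
    unfolding sum_blocks sum_words_mult by (intro sum.cong refl point)
  also have "\<dots> = (\<Sum>c<?P. \<Sum>z<?Q. \<Sum>ys\<in>words ?P k. \<Sum>zs\<in>words ?Q k.
      low_sign l r ys c * cube (carry l r ys c) (dilate ?Q bs zs) (?Q * a + z))"
    by (rule sum.swap)
  also have "\<dots> = (\<Sum>c<?P. \<Sum>ys\<in>words ?P k. \<Sum>z<?Q. \<Sum>zs\<in>words ?Q k.
      low_sign l r ys c * cube (carry l r ys c) (dilate ?Q bs zs) (?Q * a + z))"
    by (intro sum.cong refl sum.swap)
  finally show ?thesis
    by (simp only: cube_sum_def[of "2 ^ m"] sum_distrib_left sum.cartesian_product[symmetric])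
qed

text \<open>This collects what box sums for odd \<open>d\<close> have in common with differences of
  two box sums for any \<open>d\<close>, so that one contraction argument serves both. The argument
  \<open>m\<close> is the binary logarithm of the side length.\<close>

definition sign_recursion ::
  "nat \<Rightarrow> nat \<Rightarrow> nat \<Rightarrow> nat \<Rightarrow> real \<Rightarrow> (nat \<Rightarrow> (bool list \<Rightarrow> nat list) \<Rightarrow> real) \<Rightarrow> bool" where
  "sign_recursion d K k l C F \<longleftrightarrow>
    (\<forall>m r. bounded_offsets d K r \<longrightarrow> F (m + l) r =
      (\<Sum>(c, ys)\<in>{..<2 ^ l} \<times> words (2 ^ l) k. low_sign l r ys c * F m (carry l r ys c))) \<and>
    (\<forall>r. bounded_offsets d K r \<longrightarrow> \<bar>F 0 r\<bar> \<le> C) \<and>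
    (even d \<longrightarrow> (\<forall>m. F m (\<lambda>w. replicate d 0) = 0))"

text \<open>The two low parts of \<open>opposite_low_parts\<close> lead to the same state, where their contributions cancel
  if \<open>d\<close> is odd and vanish if \<open>d\<close> is even. So they are lost from the triangle inequality.\<close>

lemma low_sign_contraction:
  assumes "Suc k \<le> K"
  shows "\<exists>l \<theta>. 0 \<le> \<theta> \<and> \<theta> < 1 \<and> (\<forall>F C j r. sign_recursion d K k l C F \<longrightarrow> bounded_offsets d K r \<longrightarrow>
    \<bar>F (j * l) r\<bar> \<le> C * (\<theta> * real ((2 ^ l) ^ Suc k)) ^ j)"
proof -
  obtain l c1 ys1 where c1: "c1 < 2 ^ l" and ys1: "ys1 \<in> words (2 ^ l) k"
    and ne: "(c1, ys1) \<noteq> (0, replicate k 0)"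
    and opp: "\<And>r. bounded_offsets d K r \<Longrightarrow> carry l r (replicate k 0) 0 = (\<lambda>w. replicate d 0)"
      "\<And>r. bounded_offsets d K r \<Longrightarrow> carry l r ys1 c1 = (\<lambda>w. replicate d 0)"
      "\<And>r. bounded_offsets d K r \<Longrightarrow>
        low_sign l r ys1 c1 = (- 1) ^ d * low_sign l r (replicate k 0) 0"
    using opposite_low_parts[of k d K] by blast
  define Y where "Y = {..<2 ^ l :: nat} \<times> words (2 ^ l) k"
  define E where "E = {(0, replicate k 0), (c1, ys1)}"
  have fin: "finite Y"
    by (simp add: Y_def)
  have card: "card Y = (2 ^ l) ^ Suc k"
    by (simp add: Y_def)
  have EY: "E \<subseteq> Y"
    using c1 ys1 by (auto simp: E_def Y_def words_def)
  have cardE: "card E = 2"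
    using ne by (auto simp: E_def card_2_iff)
  have Y2: "2 \<le> card Y"
    using card_mono[OF fin EY] cardE by simp
  \<comment> \<open>In each step two of the \<open>card Y\<close> terms are lost;
    \<open>2 \<le> card Y\<close> makes this factor nonnegative.\<close>
  define \<theta> where "\<theta> = 1 - 2 / real (card Y)"
  have \<theta>Y: "\<theta> * real (card Y) = real (card Y) - 2"
    using Y2 by (simp add: \<theta>_def field_simps)
  have "\<bar>F (j * l) r\<bar> \<le> C * (\<theta> * real (card Y)) ^ j"
    if F: "sign_recursion d K k l C F" and r: "bounded_offsets d K r" for F C j r
    using r
  proof (induction j arbitrary: r)
    case (Suc j)
    let ?f = "\<lambda>(c, ys). low_sign l r ys c * F (j * l) (carry l r ys c)"
    have "sum ?f E = 0"
      using ne F opp Suc.prems by (cases "even d") (auto simp: E_def sign_recursion_def)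
    then have "sum ?f Y = sum ?f (Y - E)"
      using sum.subset_diff[OF EY fin, of ?f] by simp
    moreover have "\<bar>?f x\<bar> \<le> C * (\<theta> * real (card Y)) ^ j" if "x \<in> Y - E" for x
      using that Suc.IH[OF bounded_offsets_carry[OF Suc.prems assms]]
      by (auto simp: Y_def abs_mult)
    then have "\<bar>sum ?f (Y - E)\<bar> \<le> real (card (Y - E)) * (C * (\<theta> * real (card Y)) ^ j)"
      by (intro order_trans[OF sum_abs] sum_bounded_above)
    moreover have "real (card (Y - E)) = \<theta> * real (card Y)"
      using \<theta>Y Y2 cardE EY fin by (simp add: card_Diff_subset finite_subset of_nat_diff)
    moreover have "F (Suc j * l) r = sum ?f Y"
      using F Suc.prems unfolding sign_recursion_def Y_def mult_Suc add.commute[of l] by blast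
    ultimately show ?case
      by (simp add: ac_simps)
  qed (use F in \<open>simp add: sign_recursion_def\<close>)
  moreover have "0 \<le> \<theta>" "\<theta> < 1"
    using Y2 by (simp_all add: \<theta>_def)
  ultimately show ?thesis
    unfolding card by blast
qed

text \<open>Zero offsets, even in number, give an even power of a sign. The sum does not depend on
  the position of the box, so it cancels in differences.\<close>

lemma cube_sum_zero_state:
  assumes "even d"
  shows "cube_sum M k a bs (cube (\<lambda>w. replicate d 0)) = real M ^ Suc k"
proof -
  have "cube (\<lambda>w. replicate d 0) hs n = 1" for hs n
    using assms by (metis abs_cube cube_replicate power_even_abs power_one)
  then show ?thesis
    by (simp add: cube_sum_def)
qed

text \<open>The choice of \<open>l\<close> and \<open>m\<close> precedes \<open>F\<close>, which
  makes the decay uniform over all positions of boxes. The scale is \<open>m = j * l\<close> with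
  \<open>C * \<theta> ^ j < \<epsilon>\<close>.\<close>

lemma low_sign_decay:
  fixes \<epsilon> C :: real
  assumes "Suc k \<le> K" "0 < \<epsilon>"
  shows "\<exists>l m. \<forall>F r. sign_recursion d K k l C F \<longrightarrow> bounded_offsets d K r \<longrightarrow>
    \<bar>F m r\<bar> \<le> \<epsilon> * real (2 ^ m) ^ Suc k"
proof -
  obtain l \<theta> where \<theta>: "0 \<le> \<theta>" "\<theta> < 1"
    and contr: "\<And>F C j r. \<lbrakk>sign_recursion d K k l C F; bounded_offsets d K r\<rbrakk> \<Longrightarrow>
      \<bar>F (j * l) r\<bar> \<le> C * (\<theta> * real ((2 ^ l) ^ Suc k)) ^ j"
    using low_sign_contraction[OF assms(1), of d] by blast
  have "(\<lambda>j. C * \<theta> ^ j) \<longlonglongrightarrow> C * 0"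
    using \<theta> by (intro tendsto_mult_left LIMSEQ_power_zero) simp
  then have "eventually (\<lambda>j. C * \<theta> ^ j < \<epsilon>) sequentially"
    using assms(2) by (intro order_tendstoD) auto
  then obtain j where j: "C * \<theta> ^ j < \<epsilon>"
    by (auto simp: eventually_sequentially)
  have "((2 ^ l) ^ Suc k) ^ j = ((2 :: nat) ^ (j * l)) ^ Suc k"
    by (simp only: power_mult[symmetric] mult_ac)
  then have "C * (\<theta> * real ((2 ^ l) ^ Suc k)) ^ j = C * \<theta> ^ j * real (2 ^ (j * l)) ^ Suc k"
    by (simp only: power_mult_distrib of_nat_power[symmetric] mult.assoc)
  also have "\<dots> \<le> \<epsilon> * real (2 ^ (j * l)) ^ Suc k"
    using j by (intro mult_right_mono) auto
  finally have "C * (\<theta> * real ((2 ^ l) ^ Suc k)) ^ j \<le> \<epsilon> * real (2 ^ (j * l)) ^ Suc k" .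
  then have "\<forall>F r. sign_recursion d K k l C F \<longrightarrow> bounded_offsets d K r \<longrightarrow>
      \<bar>F (j * l) r\<bar> \<le> \<epsilon> * real (2 ^ (j * l)) ^ Suc k"
    using order_trans[OF contr] by blast
  then show ?thesis
    by blast
qed

text \<open>In the bound, \<open>sum_list J\<close> dominates every offset and \<open>Suc k\<close>
  secures stability under carries.\<close>

lemma bounded_offsets_const:
  "bounded_offsets (length J) (Suc k + sum_list J) (\<lambda>w. J)"
  using member_le_sum_list[of _ J] by (auto simp: bounded_offsets_def intro: le_SucI trans_le_add2)

lemma abs_cube_sum_one: "\<bar>cube_sum (2 ^ 0) k a bs (cube r)\<bar> \<le> 1"
proof -
  have "\<bar>\<Sum>hs\<in>words 1 k. cube r (dilate 1 bs hs) a\<bar> \<le> (\<Sum>hs\<in>words 1 k. \<bar>cube r (dilate 1 bs hs) a\<bar>)"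
    by (rule sum_abs)
  then show ?thesis
    by (simp add: cube_sum_def)
qed

text \<open>Differences of two box sums satisfy the recursion for either parity: if the number of
  offsets is even, the zero state contributes equal sums to both boxes.\<close>

lemma cube_sum_oscillation:
  assumes "0 < \<epsilon>"
  obtains M where "0 < M"
    "\<And>a bs a' bs'. length bs = k \<Longrightarrow> length bs' = k \<Longrightarrow>
      \<bar>cube_sum M k a bs (cube (\<lambda>w. J)) - cube_sum M k a' bs' (cube (\<lambda>w. J))\<bar> \<le> \<epsilon> * real M ^ Suc k"
proof -
  let ?d = "length J" and ?K = "Suc k + sum_list J"
  obtain l m where decay: "\<And>F r. sign_recursion ?d ?K k l 2 F \<Longrightarrow> bounded_offsets ?d ?K r \<Longrightarrow>
      \<bar>F m r\<bar> \<le> \<epsilon> * real (2 ^ m) ^ Suc k"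
    using low_sign_decay[of k ?K \<epsilon> ?d 2] assms by auto
  show thesis
  proof (rule that)
    fix a a' :: nat and bs bs' :: "nat list"
    assume len: "length bs = k" "length bs' = k"
    let ?F = "\<lambda>m r. cube_sum (2 ^ m) k a bs (cube r) - cube_sum (2 ^ m) k a' bs' (cube r)"
    have "?F (m + l) r = (\<Sum>(c, ys)\<in>{..<2 ^ l} \<times> words (2 ^ l) k.
        low_sign l r ys c * ?F m (carry l r ys c))" for m r
      by (simp only: cube_sum_split[OF len(1)] cube_sum_split[OF len(2)] case_prod_unfold
          right_diff_distrib sum_subtractf)
    moreover have "\<bar>?F 0 r\<bar> \<le> 2" for r
      using abs_cube_sum_one[of k a bs r] abs_cube_sum_one[of k a' bs' r] by linarith
    moreover have "?F m (\<lambda>w. replicate ?d 0) = 0" if "even ?d" for m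
      using that by (simp add: cube_sum_zero_state)
    ultimately have "sign_recursion ?d ?K k l 2 ?F"
      unfolding sign_recursion_def by blast
    from decay[OF this bounded_offsets_const]
    show "\<bar>?F m (\<lambda>w. J)\<bar> \<le> \<epsilon> * real (2 ^ m) ^ Suc k" .
  qed simp
qed

lemma cube_sum_small:
  assumes "0 < \<epsilon>" "odd (length J)"
  obtains M where "0 < M"
    "\<And>a bs. length bs = k \<Longrightarrow> \<bar>cube_sum M k a bs (cube (\<lambda>w. J))\<bar> \<le> \<epsilon> * real M ^ Suc k"
proof -
  let ?d = "length J" and ?K = "Suc k + sum_list J"
  obtain l m where decay: "\<And>F r. sign_recursion ?d ?K k l 1 F \<Longrightarrow> bounded_offsets ?d ?K r \<Longrightarrow>
      \<bar>F m r\<bar> \<le> \<epsilon> * real (2 ^ m) ^ Suc k"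
    using low_sign_decay[of k ?K \<epsilon> ?d 1] assms(1) by auto
  show thesis
  proof (rule that)
    fix a :: nat and bs :: "nat list"
    assume len: "length bs = k"
    have "sign_recursion ?d ?K k l 1 (\<lambda>m r. cube_sum (2 ^ m) k a bs (cube r))"
      using assms(2) cube_sum_split[OF len] abs_cube_sum_one unfolding sign_recursion_def by blast
    from decay[OF this bounded_offsets_const]
    show "\<bar>cube_sum (2 ^ m) k a bs (cube (\<lambda>w. J))\<bar> \<le> \<epsilon> * real (2 ^ m) ^ Suc k" .
  qed simp
qed

section \<open>Uniform means and Folner averages\<close>

text \<open>One window length serves all positions, aligned or not; this uniformity is what
  transfers the mean to every Folner sequence.\<close>

definition uniform_mean :: "(nat \<Rightarrow> real) \<Rightarrow> real \<Rightarrow> bool" where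
  "uniform_mean f c \<longleftrightarrow> (\<forall>\<epsilon>>0. \<exists>L>0. \<forall>a. \<bar>(\<Sum>j<L. f (a + j)) - c * real L\<bar> \<le> \<epsilon> * real L)"

lemma window_shift:
  fixes f :: "nat \<Rightarrow> real"
  assumes "\<And>n. \<bar>f n\<bar> \<le> 1"
  shows "\<bar>(\<Sum>j<L. f (a + r + j)) - (\<Sum>j<L. f (a + j))\<bar> \<le> 2 * real r"
proof (induction r)
  case (Suc r)
  have "(\<Sum>j<L. f (a + Suc r + j)) = (\<Sum>j<L. f (a + r + j)) + f (a + r + L) - f (a + r)"
    using sum.lessThan_Suc_shift[of "\<lambda>j. f (a + r + j)" L] by simp
  with Suc assms[of "a + r + L"] assms[of "a + r"] show ?case
    by simp
qed simp

text \<open>Long averages are close to the average over any single aligned block, since all blocks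
  nearly agree. Hence they form a Cauchy sequence, and its limit is near every block average. A
  window of \<open>B\<close> blocks at any position is a shift by less than \<open>M\<close> of an
  aligned one.\<close>

lemma block_oscillation_mean:
  fixes f :: "nat \<Rightarrow> real"
  assumes bounded: "\<And>n. \<bar>f n\<bar> \<le> 1"
    and osc: "\<And>\<epsilon>. \<epsilon> > 0 \<Longrightarrow>
      \<exists>M>0. \<forall>b b'. \<bar>(\<Sum>j<M. f (M * b + j)) - (\<Sum>j<M. f (M * b' + j))\<bar> \<le> \<epsilon> * real M"
  shows "\<exists>c. cesaro f c \<and> uniform_mean f c"
proof -
  define A where "A N = (\<Sum>n<N. f n) / real N" for N
  have near: "\<exists>M>0. \<exists>N0. \<forall>N\<ge>N0. \<forall>b. \<bar>(\<Sum>j<M. f (M * b + j)) - A N * real M\<bar> \<le> \<epsilon> * real M"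
    if \<epsilon>: "\<epsilon> > 0" for \<epsilon>
  proof -
    obtain M where M: "M > 0" and oscM:
      "\<And>b b'. \<bar>(\<Sum>j<M. f (M * b + j)) - (\<Sum>j<M. f (M * b' + j))\<bar> \<le> \<epsilon> / 2 * real M"
      using osc[of "\<epsilon> / 2"] \<epsilon> by auto
    \<comment> \<open>After multiplication by \<open>M\<close>, the incomplete last block causes two
      errors of at most \<open>M * M\<close> each; this choice keeps them below half of the
      tolerance.\<close>
    obtain N0 where N0: "real N0 > 4 * real M / \<epsilon>"
      using reals_Archimedean2 by blast
    have "\<bar>(\<Sum>j<M. f (M * b + j)) - A N * real M\<bar> \<le> \<epsilon> * real M" if N: "N \<ge> N0" for N b
    proof -
      define T where "T = (\<Sum>j<M. f (M * b + j))"
      define B where "B = N div M"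
      define t where "t = N mod M"
      have NB: "N = M * B + t" and t: "t < M"
        using M by (simp_all add: B_def t_def)
      have absT: "\<bar>T\<bar> \<le> real M"
        unfolding T_def using sum_bounded_above[of "{..<M}" "\<lambda>j. \<bar>f (M * b + j)\<bar>" 1] bounded
        by (intro order_trans[OF sum_abs]) simp
      have "(\<Sum>n<N. f n) = (\<Sum>n<M * B. f n) + (\<Sum>j<t. f (M * B + j))"
        unfolding NB by (induction t) simp_all
      moreover have "\<bar>\<Sum>j<t. f (M * B + j)\<bar> \<le> real M"
        using sum_bounded_above[of "{..<t}" "\<lambda>j. \<bar>f (M * B + j)\<bar>" 1] bounded t
        by (intro order_trans[OF sum_abs]) simp
      moreover have "\<bar>(\<Sum>n<M * B. f n) - real B * T\<bar> \<le> real B * (\<epsilon> / 2 * real M)"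
      proof -
        have "(\<Sum>n<M * B. f n) - real B * T = (\<Sum>i<B. (\<Sum>j<M. f (M * i + j)) - T)"
          by (simp add: sum_blocks sum_subtractf)
        also have "\<bar>\<dots>\<bar> \<le> (\<Sum>i<B. \<epsilon> / 2 * real M)"
          unfolding T_def by (intro order_trans[OF sum_abs] sum_mono oscM)
        finally show ?thesis
          by simp
      qed
      ultimately have "\<bar>(\<Sum>n<N. f n) - real B * T\<bar> \<le> real B * (\<epsilon> / 2 * real M) + real M"
        by linarith
      \<comment> \<open>Multiplying by \<open>M\<close> allows \<open>M * B\<close> to be replaced
        by \<open>N\<close> at the cost of \<open>t * T\<close>.\<close>
      then have "real M * \<bar>(\<Sum>n<N. f n) - real B * T\<bar> \<le> real M * (real B * (\<epsilon> / 2 * real M) + real M)"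
        by (rule mult_left_mono) simp
      then have "\<bar>real M * (\<Sum>n<N. f n) - real (M * B) * T\<bar> \<le> real M * (real B * (\<epsilon> / 2 * real M) + real M)"
        unfolding of_nat_mult mult.assoc right_diff_distrib[symmetric] abs_mult by simp
      moreover have "real (M * B) * T = real N * T - real t * T"
        by (simp add: NB algebra_simps)
      moreover have "\<bar>real t * T\<bar> \<le> real M * real M"
        unfolding abs_mult using t absT by (intro mult_mono) auto
      moreover have "real M * (real B * (\<epsilon> / 2 * real M)) \<le> \<epsilon> / 2 * real M * real N"
        using \<epsilon> by (simp add: NB algebra_simps)
      moreover have "2 * (real M * real M) \<le> \<epsilon> / 2 * real M * real N"
      proof -
        have "4 * real M \<le> \<epsilon> * real N0"
          using N0 \<epsilon> by (simp add: field_simps)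
        also have "\<dots> \<le> \<epsilon> * real N"
          using N \<epsilon> by simp
        finally have "real M * (4 * real M) \<le> real M * (\<epsilon> * real N)"
          by (rule mult_left_mono) simp
        then show ?thesis
          by (simp add: mult_ac)
      qed
      ultimately have "\<bar>real M * (\<Sum>n<N. f n) - real N * T\<bar> \<le> \<epsilon> * real M * real N"
        by (simp add: distrib_left)
      moreover have N_pos: "N > 0"
        using N0 N M \<epsilon> by (cases "N = 0") (auto simp: field_simps not_less[symmetric])
      have "real M * (\<Sum>n<N. f n) - real N * T = real N * (A N * real M - T)"
        using N_pos by (simp add: A_def algebra_simps)
      then have "\<bar>real M * (\<Sum>n<N. f n) - real N * T\<bar> = real N * \<bar>T - A N * real M\<bar>"
        by (simp only: abs_mult abs_of_nat abs_minus_commute)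
      ultimately have "real N * \<bar>T - A N * real M\<bar> \<le> real N * (\<epsilon> * real M)"
        by (simp add: mult_ac)
      with N_pos show ?thesis
        by (simp add: T_def)
    qed
    with M show ?thesis
      by blast
  qed
  have "Cauchy A"
  proof (rule metric_CauchyI)
    fix \<epsilon> :: real
    assume \<epsilon>: "\<epsilon> > 0"
    then obtain M N0 where M: "M > 0" and close: "\<And>N b. N \<ge> N0 \<Longrightarrow>
        \<bar>(\<Sum>j<M. f (M * b + j)) - A N * real M\<bar> \<le> \<epsilon> / 3 * real M"
      using near[of "\<epsilon> / 3"] by auto
    have "dist (A N) (A N') < \<epsilon>" if "N \<ge> N0" "N' \<ge> N0" for N N'
    proof -
      have "\<bar>A N * real M - A N' * real M\<bar> \<le> 2 * \<epsilon> / 3 * real M"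
        using close[OF that(1), of 0] close[OF that(2), of 0] by linarith
      then have "\<bar>A N - A N'\<bar> * real M \<le> 2 * \<epsilon> / 3 * real M"
        by (simp add: left_diff_distrib[symmetric] abs_mult)
      with M have "\<bar>A N - A N'\<bar> \<le> 2 * \<epsilon> / 3"
        by simp
      with \<epsilon> show ?thesis
        by (simp add: dist_real_def)
    qed
    then show "\<exists>N0. \<forall>N\<ge>N0. \<forall>N'\<ge>N0. dist (A N) (A N') < \<epsilon>"
      by blast
  qed
  then obtain c where c: "A \<longlonglongrightarrow> c"
    using Cauchy_convergent convergent_def by blast
  have "\<exists>L>0. \<forall>a. \<bar>(\<Sum>j<L. f (a + j)) - c * real L\<bar> \<le> \<epsilon> * real L" if \<epsilon>: "\<epsilon> > 0" for \<epsilon>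
  proof -
    obtain M N0 where M: "M > 0" and close: "\<And>N b. N \<ge> N0 \<Longrightarrow>
        \<bar>(\<Sum>j<M. f (M * b + j)) - A N * real M\<bar> \<le> \<epsilon> / 2 * real M"
      using near[of "\<epsilon> / 2"] \<epsilon> by auto
    have block: "\<bar>(\<Sum>j<M. f (M * b + j)) - c * real M\<bar> \<le> \<epsilon> / 2 * real M" for b
    proof (rule LIMSEQ_le_const2)
      show "(\<lambda>N. \<bar>(\<Sum>j<M. f (M * b + j)) - A N * real M\<bar>) \<longlonglongrightarrow> \<bar>(\<Sum>j<M. f (M * b + j)) - c * real M\<bar>"
        by (intro tendsto_intros c)
      show "\<exists>N0. \<forall>N\<ge>N0. \<bar>(\<Sum>j<M. f (M * b + j)) - A N * real M\<bar> \<le> \<epsilon> / 2 * real M"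
        using close by blast
    qed
    \<comment> \<open>Aligning a window costs at most \<open>2 * M\<close>, which is then at most
      half of the tolerance.\<close>
    obtain B where B: "real B > 4 / \<epsilon>"
      using reals_Archimedean2 by blast
    then have "B > 0"
      using \<epsilon> by (cases "B = 0") (auto simp: field_simps)
    have "\<bar>(\<Sum>j<M * B. f (a + j)) - c * real (M * B)\<bar> \<le> \<epsilon> * real (M * B)" for a
    proof -
      define q where "q = a div M"
      have a: "a = M * q + a mod M" "a mod M < M"
        using M by (simp_all add: q_def)
      have "(\<Sum>j<M * B. f (M * q + j)) - c * real (M * B)
          = (\<Sum>b<B. (\<Sum>j<M. f (M * (q + b) + j)) - c * real M)"
        by (simp only: sum_blocks distrib_left add.assoc) (simp add: sum_subtractf)
      also have "\<bar>\<dots>\<bar> \<le> (\<Sum>b<B. \<epsilon> / 2 * real M)"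
        by (intro order_trans[OF sum_abs] sum_mono block)
      also have "\<dots> = \<epsilon> / 2 * real (M * B)"
        by simp
      finally have 1: "\<bar>(\<Sum>j<M * B. f (M * q + j)) - c * real (M * B)\<bar> \<le> \<epsilon> / 2 * real (M * B)" .
      have 2: "\<bar>(\<Sum>j<M * B. f (a + j)) - (\<Sum>j<M * B. f (M * q + j))\<bar> \<le> 2 * real M"
        using window_shift[where f = f, OF bounded, where a = "M * q" and r = "a mod M" and L = "M * B"] a by simp
      have "4 * real M \<le> \<epsilon> * real B * real M"
        using B \<epsilon> by (intro mult_right_mono) (auto simp: field_simps)
      then have "2 * real M \<le> \<epsilon> / 2 * real (M * B)"
        by (simp add: mult_ac)
      with 1 2 show ?thesis
        by linarith
    qed
    with M \<open>B > 0\<close> show ?thesis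
      by (intro exI[of _ "M * B"]) auto
  qed
  with c show ?thesis
    unfolding uniform_mean_def cesaro_def A_def by blast
qed

section \<open>Averages along Folner sequences\<close>

lemma folner_sum_shift:
  fixes f :: "nat \<Rightarrow> real"
  assumes "finite F" "\<And>n. \<bar>f n\<bar> \<le> 1"
  shows "\<bar>(\<Sum>n\<in>F. f (n + j)) - (\<Sum>n\<in>F. f n)\<bar> \<le> real (card (sym_diff F ((\<lambda>n. n + j) ` F)))"
proof -
  let ?G = "(\<lambda>n. n + j) ` F"
  have fin: "finite ?G"
    using assms(1) by simp
  have bound: "\<bar>sum f S\<bar> \<le> real (card S)" for S
    using sum_bounded_above[of S "\<lambda>n. \<bar>f n\<bar>" 1] assms(2) by (intro order_trans[OF sum_abs]) simp
  have "(\<Sum>n\<in>F. f (n + j)) = sum f ?G"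
    by (subst sum.reindex) auto
  moreover have "sum f ?G = sum f (?G - F) + sum f (F \<inter> ?G)" "sum f F = sum f (F - ?G) + sum f (F \<inter> ?G)"
    using sum.Int_Diff[OF fin, of f F] sum.Int_Diff[OF assms(1), of f ?G] by (simp_all add: Int_commute)
  moreover have "card (sym_diff F ?G) = card (F - ?G) + card (?G - F)"
    using assms(1) fin by (intro card_Un_disjoint) auto
  ultimately show ?thesis
    using bound[of "F - ?G"] bound[of "?G - F"] by simp
qed

text \<open>Asymptotic invariance under the shifts by \<open>j < L\<close> allows \<open>f\<close>
  to be replaced by its window means of length \<open>L\<close>, all of which are close to
  \<open>c\<close>.\<close>

lemma folner_average:
  fixes f :: "nat \<Rightarrow> real"
  assumes "folner \<Phi>" "\<And>n. \<bar>f n\<bar> \<le> 1" "uniform_mean f c"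
  shows "(\<lambda>N. average (\<Phi> N) (\<lambda>n. of_real (f n))) \<longlonglongrightarrow> of_real c"
proof -
  have fin: "finite (\<Phi> N)" and pos: "card (\<Phi> N) > 0" for N
    using assms(1) by (auto simp: folner_def card_gt_0_iff)
  define D where "D j N = real (card (sym_diff (\<Phi> N) ((\<lambda>n. n + j) ` \<Phi> N))) / real (card (\<Phi> N))" for j N
  have D: "D j \<longlonglongrightarrow> 0" for j
    using assms(1) unfolding folner_def D_def by (cases "j = 0") (auto simp: Suc_le_eq)
  have "(\<lambda>N. (\<Sum>n\<in>\<Phi> N. f n) / real (card (\<Phi> N))) \<longlonglongrightarrow> c"
  proof (rule LIMSEQ_I)
    fix \<epsilon> :: real
    assume \<epsilon>: "0 < \<epsilon>"
    then obtain L where L: "L > 0"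
      and mean: "\<And>a. \<bar>(\<Sum>j<L. f (a + j)) - c * real L\<bar> \<le> \<epsilon> / 2 * real L"
      using assms(3) unfolding uniform_mean_def by (metis half_gt_zero)
    have "(\<lambda>N. (\<Sum>j<L. D j N) / real L) \<longlonglongrightarrow> (\<Sum>j<L. 0) / real L"
      using L by (intro tendsto_intros D) simp
    then have "eventually (\<lambda>N. (\<Sum>j<L. D j N) / real L < \<epsilon> / 2) sequentially"
      using \<epsilon> by (intro order_tendstoD) auto
    then obtain N0 where N0: "\<And>N. N \<ge> N0 \<Longrightarrow> (\<Sum>j<L. D j N) / real L < \<epsilon> / 2"
      by (auto simp: eventually_sequentially)
    have "\<bar>(\<Sum>n\<in>\<Phi> N. f n) / real (card (\<Phi> N)) - c\<bar> < \<epsilon>" if "N \<ge> N0" for N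
    proof -
      let ?F = "\<Phi> N" and ?C = "real (card (\<Phi> N))"
      let ?S = "\<Sum>n\<in>?F. f n" and ?W = "\<Sum>n\<in>?F. \<Sum>j<L. f (n + j)"
      have C: "?C > 0"
        using pos by simp
      have "?W - real L * ?S = (\<Sum>j<L. (\<Sum>n\<in>?F. f (n + j)) - ?S)"
        by (subst sum.swap) (simp add: sum_subtractf)
      also have "\<bar>\<dots>\<bar> \<le> (\<Sum>j<L. ?C * D j N)"
        using C folner_sum_shift[where f = f, OF fin assms(2)]
        by (intro order_trans[OF sum_abs] sum_mono) (simp add: D_def)
      also have "\<dots> = ?C * (\<Sum>j<L. D j N)"
        by (simp add: sum_distrib_left)
      also have "\<dots> < ?C * (\<epsilon> / 2 * real L)"
        using N0[OF that] L C by (intro mult_strict_left_mono) (simp_all add: field_simps)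
      finally have 1: "\<bar>?W - real L * ?S\<bar> < ?C * (\<epsilon> / 2 * real L)" .
      have "?W - ?C * (c * real L) = (\<Sum>n\<in>?F. (\<Sum>j<L. f (n + j)) - c * real L)"
        by (simp add: sum_subtractf)
      also have "\<bar>\<dots>\<bar> \<le> (\<Sum>n\<in>?F. \<epsilon> / 2 * real L)"
        by (intro order_trans[OF sum_abs] sum_mono mean)
      finally have 2: "\<bar>?W - ?C * (c * real L)\<bar> \<le> ?C * (\<epsilon> / 2 * real L)"
        by simp
      have "\<bar>real L * ?S - ?C * (c * real L)\<bar> < ?C * (\<epsilon> / 2 * real L) + ?C * (\<epsilon> / 2 * real L)"
        using 1 2 by linarith
      also have "\<dots> = ?C * (\<epsilon> * real L)"
        by simp
      finally have "\<bar>real L * ?S - ?C * (c * real L)\<bar> < ?C * (\<epsilon> * real L)" .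
      moreover have "real L * ?S - ?C * (c * real L) = (?C * real L) * (?S / ?C - c)"
        using C by (simp add: field_simps)
      ultimately have "(?C * real L) * \<bar>?S / ?C - c\<bar> < (?C * real L) * \<epsilon>"
        using C L by (simp add: abs_mult mult_ac)
      with C L show ?thesis
        by (simp add: mult_less_cancel_left)
    qed
    then show "\<exists>no. \<forall>N\<ge>no. norm ((\<Sum>n\<in>\<Phi> N. f n) / real (card (\<Phi> N)) - c) < \<epsilon>"
      by auto
  qed
  then have "(\<lambda>N. complex_of_real ((\<Sum>n\<in>\<Phi> N. f n) / real (card (\<Phi> N)))) \<longlonglongrightarrow> of_real c"
    by (rule tendsto_of_real)
  then show ?thesis
    by (simp add: average_def)
qed

section \<open>Gowers norms of the Thue--Morse sequence\<close>

lemma shift_prod_mean: "\<exists>c. cesaro (shift_prod J) c \<and> uniform_mean (shift_prod J) c"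
proof (rule block_oscillation_mean)
  fix \<epsilon> :: real
  assume "0 < \<epsilon>"
  then obtain M where "0 < M" "\<And>a bs a' bs'. length bs = 0 \<Longrightarrow> length bs' = 0 \<Longrightarrow>
      \<bar>cube_sum M 0 a bs (cube (\<lambda>w. J)) - cube_sum M 0 a' bs' (cube (\<lambda>w. J))\<bar> \<le> \<epsilon> * real M ^ Suc 0"
    by (rule cube_sum_oscillation[where k = 0 and J = J]) blast
  then show "\<exists>M>0. \<forall>b b'. \<bar>(\<Sum>j<M. shift_prod J (M * b + j)) - (\<Sum>j<M. shift_prod J (M * b' + j))\<bar>
      \<le> \<epsilon> * real M"
    by (auto simp: cube_sum_0)
qed simp

text \<open>Block sums of the inner limits \<open>y\<close> are again iterated limits, so the
  oscillation bound for boxes in one dimension more passes to them by \<open>itlim_abs_le\<close>.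
  The outer Cesaro limit then exists by \<open>block_oscillation_mean\<close>.\<close>

lemma itlim_cube_exists: "\<exists>z. itlim k (cube (\<lambda>w. J)) z"
proof (induction k arbitrary: J)
  case 0
  have "cube (\<lambda>w. J) [] = shift_prod J"
    by (rule ext) simp
  then show ?case
    using shift_prod_mean[of J] by auto
next
  case (Suc k)
  have "\<exists>y. \<forall>h. itlim k (\<lambda>hs. cube (\<lambda>w. J) (h # hs)) (y h)"
    unfolding cube_const_Cons by (intro choice allI Suc)
  then obtain y where y: "\<And>h. itlim k (\<lambda>hs. cube (\<lambda>w. J) (h # hs)) (y h)"
    by blast
  have "\<exists>c. cesaro y c \<and> uniform_mean y c"
  proof (rule block_oscillation_mean)
    show "\<bar>y h\<bar> \<le> 1" for h
    proof (rule itlim_abs_le[OF y])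
      show "\<bar>cube_sum 1 k a bs (\<lambda>hs. cube (\<lambda>w. J) (h # hs))\<bar> \<le> 1 * real 1 ^ Suc k" for a bs
        using abs_cube_sum_one[of k a bs] by (simp add: cube_const_Cons)
    qed simp
    fix \<epsilon> :: real
    assume "0 < \<epsilon>"
    then obtain M where M: "0 < M" and osc: "\<And>a bs a' bs'. length bs = Suc k \<Longrightarrow> length bs' = Suc k \<Longrightarrow>
      \<bar>cube_sum M (Suc k) a bs (cube (\<lambda>w. J)) - cube_sum M (Suc k) a' bs' (cube (\<lambda>w. J))\<bar>
        \<le> \<epsilon> * real M ^ Suc (Suc k)"
      by (rule cube_sum_oscillation[where k = "Suc k" and J = J]) blast
    have "\<bar>(\<Sum>h<M. y (M * b + h)) - (\<Sum>h<M. y (M * b' + h))\<bar> \<le> \<epsilon> * real M" for b b'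
    proof (rule itlim_abs_le[OF _ M])
      let ?G = "\<lambda>b hs n. \<Sum>h<M. cube (\<lambda>w. J) ((M * b + h) # hs) n"
      have block: "itlim k (?G b) (\<Sum>h<M. y (M * b + h))" for b
        by (intro itlim_sum y)
      show "itlim k (\<lambda>hs n. ?G b hs n - ?G b' hs n) ((\<Sum>h<M. y (M * b + h)) - (\<Sum>h<M. y (M * b' + h)))"
        using itlim_add[OF block[of b] itlim_cmult[OF block[of b'], of "- 1"]] by simp
      show "\<bar>cube_sum M k a bs (\<lambda>hs n. ?G b hs n - ?G b' hs n)\<bar> \<le> \<epsilon> * real M * real M ^ Suc k"
        if "length bs = k" for a bs
        using osc[of "b # bs" "b' # bs" a a] that
        by (simp only: cube_sum_diff cube_sum_Suc length_Cons power_Suc mult.assoc)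
    qed
    with M show "\<exists>M>0. \<forall>b b'. \<bar>(\<Sum>j<M. y (M * b + j)) - (\<Sum>j<M. y (M * b' + j))\<bar> \<le> \<epsilon> * real M"
      by blast
  qed
  with y show ?case
    by auto
qed

lemma itlim_cube_odd:
  assumes "itlim k (cube (\<lambda>w. J)) z" "odd (length J)"
  shows "z = 0"
proof -
  have "\<bar>z\<bar> \<le> \<epsilon>" if \<epsilon>: "0 < \<epsilon>" for \<epsilon>
  proof -
    obtain M where "0 < M" "\<And>a bs. length bs = k \<Longrightarrow> \<bar>cube_sum M k a bs (cube (\<lambda>w. J))\<bar> \<le> \<epsilon> * real M ^ Suc k"
      by (rule cube_sum_small[OF \<epsilon> assms(2), where k = k]) blast
    with assms(1) show ?thesis
      by (rule itlim_abs_le)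
  qed
  then have "\<bar>z\<bar> \<le> 0"
    by (rule field_le_epsilon) simp
  then show ?thesis
    by simp
qed

text \<open>The \<open>h\<close>-th term is the limit of \<open>g hs n * g hs (n + h)\<close>; by invariance under shifts of \<open>n\<close>, the double
  sum in \<open>cesaro_nonneg\<close> is the limit of a square.\<close>

lemma itlim_cube_nonneg:
  assumes "itlim (Suc k) (cube (\<lambda>w. J)) z"
  shows "0 \<le> z"
proof -
  let ?g = "cube (\<lambda>w. J)"
  obtain y where y: "\<And>h. itlim k (\<lambda>hs. ?g (h # hs)) (y h)" "cesaro y z"
    using assms by auto
  have pair: "itlim k (\<lambda>hs n. ?g hs (n + i) * ?g hs (n + j)) (y (if i \<le> j then j - i else i - j))" for i j
  proof (cases "i \<le> j")
    case True
    then show ?thesis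
      using itlim_shift[OF y(1)[of "j - i"], of i] by (simp add: add.assoc)
  next
    case False
    then show ?thesis
      using itlim_shift[OF y(1)[of "i - j"], of j] by (simp add: add.assoc mult.commute)
  qed
  have "0 \<le> (\<Sum>i<m. \<Sum>j<m. y (if i \<le> j then j - i else i - j))" for m
  proof -
    let ?z = "\<Sum>i<m. \<Sum>j<m. y (if i \<le> j then j - i else i - j)"
    let ?G = "\<lambda>hs n. \<Sum>i<m. \<Sum>j<m. ?g hs (n + i) * ?g hs (n + j)"
    have "itlim k ?G ?z"
      by (intro itlim_sum pair)
    then have "itlim k (\<lambda>hs n. - 1 * ?G hs n) (- 1 * ?z)"
      by (rule itlim_cmult)
    moreover have "?G hs n = (\<Sum>i<m. ?g hs (n + i))\<^sup>2" for hs n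
      by (simp add: power2_eq_square sum_product)
    ultimately have "itlim k (\<lambda>hs n. - ((\<Sum>i<m. ?g hs (n + i))\<^sup>2)) (- ?z)"
      by simp
    then have "- ?z \<le> 0"
    proof (rule itlim_le)
      show "cube_sum 1 k a bs (\<lambda>hs n. - ((\<Sum>i<m. ?g hs (n + i))\<^sup>2)) \<le> 0 * real 1 ^ Suc k" for a bs
        by (simp add: cube_sum_def sum_nonneg sum_negf)
    qed simp
    then show ?thesis
      by simp
  qed
  with y(2) show ?thesis
    by (rule cesaro_nonneg)
qed

lemma average_shift_prod:
  assumes "folner \<Phi>" "cesaro (shift_prod J) c"
  shows "(\<lambda>N. average (\<Phi> N) (\<lambda>n. of_real (shift_prod J n))) \<longlonglongrightarrow> of_real c"
proof -
  obtain c' where "cesaro (shift_prod J) c'" "uniform_mean (shift_prod J) c'"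
    using shift_prod_mean by blast
  moreover from this(1) assms(2) have "c' = c"
    unfolding cesaro_def by (rule LIMSEQ_unique)
  ultimately show ?thesis
    using folner_average[OF assms(1)] by simp
qed

text \<open>The difference \<open>mult_diff h\<close> turns \<open>J\<close> into the offsets of
  \<open>cube_const_Cons\<close>, so both recursions agree and the iterated limit is the
  \<open>2 ^ k\<close>-th power of the norm.\<close>

lemma has_unorm_shift_prod:
  assumes "folner \<Phi>" "itlim k (cube (\<lambda>w. J)) z"
  shows "has_unorm \<Phi> k (\<lambda>n. of_real (shift_prod J n)) (of_real (root (2 ^ k) z))"
  using assms(2)
proof (induction k arbitrary: J z)
  case 0
  moreover have "cube (\<lambda>w. J) [] = shift_prod J"
    by (rule ext) simp
  ultimately show ?case
    using average_shift_prod[OF assms(1)] by simp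
next
  case (Suc k)
  let ?J = "\<lambda>h. J @ map (\<lambda>v. v + h) J"
  obtain y where y: "\<And>h. itlim k (cube (\<lambda>w. ?J h)) (y h)" "cesaro y z"
    using Suc.prems by (auto simp: cube_const_Cons)
  have "0 \<le> z"
    using Suc.prems by (rule itlim_cube_nonneg)
  \<comment> \<open>For \<open>k = 0\<close> the root has order 1; for larger \<open>k\<close> the
    limit is nonnegative.\<close>
  have pow: "root (2 ^ k) (y h) ^ 2 ^ k = y h" for h
  proof (cases k)
    case (Suc k')
    with y(1)[of h] have "0 \<le> y h"
      by (auto intro: itlim_cube_nonneg simp del: itlim.simps)
    then show ?thesis
      by simp
  qed simp
  have "mult_diff h (\<lambda>n. of_real (shift_prod J n)) = (\<lambda>n. of_real (shift_prod (?J h) n))" for h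
    by (rule ext) (simp add: mult_diff_def shift_prod_append shift_prod_map_add)
  then have "has_unorm \<Phi> k (mult_diff h (\<lambda>n. of_real (shift_prod J n))) (of_real (root (2 ^ k) (y h)))" for h
    using Suc.IH[OF y(1)] by simp
  moreover have "(\<lambda>H. (\<Sum>h=1..H. complex_of_real (root (2 ^ k) (y h)) ^ 2 ^ k) / of_nat H)
      \<longlonglongrightarrow> of_real (root (2 ^ Suc k) z) ^ 2 ^ Suc k"
  proof -
    \<comment> \<open>The norm averages over \<open>h = 1..H\<close>, whereas \<open>cesaro\<close>
      starts at 0.\<close>
    have "(\<lambda>H. complex_of_real ((\<Sum>h<H. y (Suc h)) / real H)) \<longlonglongrightarrow> of_real z"
      using cesaro_Suc[OF y(2)] unfolding cesaro_def by (rule tendsto_of_real)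
    moreover have "root (2 ^ Suc k) z ^ 2 ^ Suc k = z"
      using \<open>0 \<le> z\<close> by (intro real_root_pow_pos2) auto
    ultimately show ?thesis
      by (simp add: of_real_power[symmetric] pow sum.atLeast1_atMost_eq del: of_real_power power_Suc)
  qed
  moreover have "0 \<le> root (2 ^ Suc k) z"
    using \<open>0 \<le> z\<close> by (intro real_root_ge_zero)
  ultimately show ?case
    unfolding has_unorm.simps by (intro conjI exI[of _ "\<lambda>h. of_real (root (2 ^ k) (y h))"]) simp_all
qed

section \<open>From signs to indicator functions of level sets\<close>

lemma has_unorm_scale:
  fixes c :: real
  assumes "has_unorm \<Phi> k \<phi> 0"
  shows "has_unorm \<Phi> k (\<lambda>n. of_real c * \<phi> n) 0"
proof -
  \<comment> \<open>Level 0 is linear, higher levels are absolutely homogeneous. Differences scale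
    by the nonnegative factor \<open>c\<^sup>2\<close>, for which both cases of the induction
    hypothesis agree.\<close>
  have "has_unorm \<Phi> k (\<lambda>n. of_real c * \<phi> n) (of_real (if k = 0 then c else \<bar>c\<bar>) * x)"
    if "has_unorm \<Phi> k \<phi> x" for x
    using that
  proof (induction k arbitrary: c \<phi> x)
    case 0
    then have "(\<lambda>N. of_real c * average (\<Phi> N) \<phi>) \<longlonglongrightarrow> of_real c * x"
      by (intro tendsto_mult_left) simp
    then show ?case
      by (simp add: average_def sum_distrib_left)
  next
    case (Suc k)
    then obtain y where x: "x \<in> \<real>" "0 \<le> Re x"
      and y: "\<And>h. h \<ge> 1 \<Longrightarrow> has_unorm \<Phi> k (mult_diff h \<phi>) (y h)"
        "(\<lambda>H. (\<Sum>h=1..H. y h ^ 2 ^ k) / of_nat H) \<longlonglongrightarrow> x ^ 2 ^ Suc k"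
      by auto
    have "mult_diff h (\<lambda>n. of_real c * \<phi> n) = (\<lambda>n. of_real (c\<^sup>2) * mult_diff h \<phi> n)" for h
      by (rule ext) (simp add: mult_diff_def power2_eq_square)
    then have "has_unorm \<Phi> k (mult_diff h (\<lambda>n. of_real c * \<phi> n)) (of_real (c\<^sup>2) * y h)" if "h \<ge> 1" for h
      using Suc.IH[OF y(1)[OF that], of "c\<^sup>2"] by (simp add: if_distrib cong: if_cong)
    moreover have "(\<lambda>H. (\<Sum>h=1..H. (of_real (c\<^sup>2) * y h) ^ 2 ^ k) / of_nat H)
        \<longlonglongrightarrow> (of_real \<bar>c\<bar> * x) ^ 2 ^ Suc k"
    proof -
      have "(\<lambda>H. of_real ((c\<^sup>2) ^ 2 ^ k) * ((\<Sum>h=1..H. y h ^ 2 ^ k) / of_nat H))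
          \<longlonglongrightarrow> of_real ((c\<^sup>2) ^ 2 ^ k) * x ^ 2 ^ Suc k"
        by (intro tendsto_mult_left y(2))
      moreover have "\<bar>c\<bar> ^ 2 ^ Suc k = (c\<^sup>2) ^ 2 ^ k"
        by (simp add: power_mult)
      then have scale: "(of_real \<bar>c\<bar> * x) ^ 2 ^ Suc k = of_real ((c\<^sup>2) ^ 2 ^ k) * x ^ 2 ^ Suc k"
        by (simp only: power_mult_distrib of_real_power[symmetric])
      ultimately show ?thesis
        unfolding scale by (simp add: power_mult_distrib sum_distrib_left del: power_Suc)
    qed
    ultimately show ?case
      using x unfolding has_unorm.simps
      by (intro conjI exI[of _ "\<lambda>h. of_real (c\<^sup>2) * y h"]) (auto intro!: mult_nonneg_nonneg)
  qed
  from this[OF assms] show ?thesis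
    by simp
qed

lemma average_cong:
  assumes "\<And>n. n \<in> F \<Longrightarrow> \<phi> n = \<psi> n"
  shows "average F \<phi> = average F \<psi>"
  using assms by (simp add: average_def)

text \<open>Only positive arguments are read. This matters because the affine formula for the
  indicator of a level set can fail at 0.\<close>

lemma has_unorm_cong:
  assumes "folner \<Phi>" "\<And>n. n \<ge> 1 \<Longrightarrow> \<phi> n = \<psi> n" "has_unorm \<Phi> k \<phi> x"
  shows "has_unorm \<Phi> k \<psi> x"
  using assms(2,3)
proof (induction k arbitrary: \<phi> \<psi> x)
  case 0
  have "\<Phi> N \<subseteq> {1..}" for N
    using assms(1) by (simp add: folner_def)
  then have "average (\<Phi> N) \<phi> = average (\<Phi> N) \<psi>" for N
    using 0(1) by (intro average_cong) auto
  with 0 show ?case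
    by simp
next
  case (Suc k)
  have "mult_diff h \<phi> n = mult_diff h \<psi> n" if "n \<ge> 1" for h n
    using Suc.prems(1) that by (simp add: mult_diff_def)
  then have "has_unorm \<Phi> k (mult_diff h \<phi>) y \<Longrightarrow> has_unorm \<Phi> k (mult_diff h \<psi>) y" for h y
    by (rule Suc.IH)
  with Suc.prems(2) show ?case
    by auto
qed

text \<open>Each factor either contributes \<open>1 / 2\<close> or adds its shift to
  \<open>J\<close>, so expanding the product leaves a linear combination of averages of sign
  products.\<close>

lemma shift_prod_correlations:
  fixes h :: "nat \<Rightarrow> nat"
  assumes "folner \<Phi>"
  shows "convergent (\<lambda>N. average (\<Phi> N) (\<lambda>n. of_real (shift_prod J n) *
    (\<Prod>i=1..m. 1 / 2 + of_real c * of_real (tm_sign (n + h i)))))"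
proof (induction m arbitrary: J)
  case 0
  then show ?case
    using average_shift_prod[OF assms] shift_prod_mean[of J] by (auto simp: convergent_def)
next
  case (Suc m)
  let ?P = "\<lambda>n. \<Prod>i=1..m. 1 / 2 + complex_of_real c * of_real (tm_sign (n + h i))"
  have "average (\<Phi> N) (\<lambda>n. of_real (shift_prod J n) *
        (\<Prod>i=1..Suc m. 1 / 2 + of_real c * of_real (tm_sign (n + h i)))) =
      1 / 2 * average (\<Phi> N) (\<lambda>n. of_real (shift_prod J n) * ?P n) +
      of_real c * average (\<Phi> N) (\<lambda>n. of_real (shift_prod (h (Suc m) # J) n) * ?P n)" for N
    unfolding average_def by (simp add: sum_distrib_left add_divide_distrib[symmetric] sum.distrib[symmetric] algebra_simps)
  then show ?case
    using Suc[of J] Suc[of "h (Suc m) # J"]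
    by (simp only:) (intro convergent_add convergent_mult convergent_const)
qed

text \<open>On positive integers the indicator is \<open>1 / 2 + c * tm_sign n\<close> with
  \<open>c\<close> equal to plus or minus one half. The balanced part is a multiple of the sign,
  whose offset list \<open>[0]\<close> has odd length, so all its norms vanish.\<close>

lemma thue_morse_class_uniform:
  assumes "folner \<Phi>"
  shows "U_uniform \<Phi> k {n. 1 \<le> n \<and> thue_morse n = a}" (is "U_uniform \<Phi> k ?A")
proof -
  define c :: real where "c = (if a = 0 then 1 / 2 else - 1 / 2)"
  have ind: "indicator ?A n = 1 / 2 + complex_of_real c * of_real (tm_sign n)" if "n \<ge> 1" for n
    using that by (cases a; cases "thue_morse n") (simp_all add: c_def tm_sign_def)
  have \<Phi>: "finite (\<Phi> N)" "\<Phi> N \<noteq> {}" "\<Phi> N \<subseteq> {1..}" for N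
    using assms by (auto simp: folner_def)
  have single: "shift_prod [0] = tm_sign"
    by (rule ext) simp
  have balanced: "has_unorm \<Phi> k (\<lambda>n. of_real c * of_real (tm_sign n)) 0" for k
  proof (rule has_unorm_scale)
    obtain z where z: "itlim k (cube (\<lambda>w. [0])) z"
      using itlim_cube_exists by blast
    then have "z = 0"
      by (rule itlim_cube_odd) simp
    with has_unorm_shift_prod[OF assms z] show "has_unorm \<Phi> k (\<lambda>n. of_real (tm_sign n)) 0"
      by (simp add: single)
  qed
  have norm: "has_unorm \<Phi> k (\<lambda>n. indicator ?A n - of_real (1 / 2)) 0"
  proof (rule has_unorm_cong[OF assms _ balanced])
    show "of_real c * of_real (tm_sign n) = (indicator ?A n - of_real (1 / 2) :: complex)" if "n \<ge> 1" for n
      by (simp only: ind[OF that]) simp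
  qed
  have density: "has_density \<Phi> ?A (1 / 2)"
  proof -
    \<comment> \<open>At level 0 the norm is the mean, so its vanishing gives the density.\<close>
    have "(\<lambda>N. 1 / 2 + average (\<Phi> N) (\<lambda>n. of_real c * of_real (tm_sign n))) \<longlonglongrightarrow> 1 / 2 + 0"
      using balanced[of 0] by (intro tendsto_add tendsto_const) simp
    moreover have "1 / 2 + average (\<Phi> N) (\<lambda>n. of_real c * of_real (tm_sign n)) =
        complex_of_real (real (card (?A \<inter> \<Phi> N)) / real (card (\<Phi> N)))" for N
    proof -
      have "(\<Sum>n\<in>\<Phi> N. indicator ?A n) = (\<Sum>n\<in>\<Phi> N. 1 / 2 + complex_of_real c * of_real (tm_sign n))"
        using \<Phi>(3) ind by (intro sum.cong) auto
      moreover have "(\<Sum>n\<in>\<Phi> N. indicator ?A n) = (of_nat (card (?A \<inter> \<Phi> N)) :: complex)"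
        using \<Phi>(1) by (simp add: indicator_def sum_of_bool_eq Int_def conj_commute)
      ultimately have "of_nat (card (?A \<inter> \<Phi> N)) =
          of_nat (card (\<Phi> N)) * (1 / 2) + (\<Sum>n\<in>\<Phi> N. complex_of_real c * of_real (tm_sign n))"
        by (simp only: sum.distrib sum_constant)
      then have "complex_of_nat (card (?A \<inter> \<Phi> N)) / of_nat (card (\<Phi> N)) =
          1 / 2 + (\<Sum>n\<in>\<Phi> N. complex_of_real c * of_real (tm_sign n)) / of_nat (card (\<Phi> N))"
        using \<Phi>(1,2)[of N] by (simp add: add_divide_distrib)
      then show ?thesis
        by (simp add: average_def)
    qed
    ultimately have "(\<lambda>N. complex_of_real (real (card (?A \<inter> \<Phi> N)) / real (card (\<Phi> N)))) \<longlonglongrightarrow> of_real (1 / 2)"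
      by simp
    then show ?thesis
      unfolding has_density_def by (simp only: tendsto_of_real_iff)
  qed
  have "admits_correlations \<Phi> (indicator ?A)"
    unfolding admits_correlations_def
  proof (intro conjI allI impI)
    show "bounded (indicator ?A ` {1..} :: complex set)"
      by (rule boundedI[of _ 1]) (auto simp: indicator_def)
    fix m :: nat and h \<epsilon> :: "nat \<Rightarrow> nat"
    assume h: "\<forall>i\<in>{1..m}. 1 \<le> h i \<and> \<epsilon> i \<in> {0, 1}"
    have "(\<Prod>i=1..m. (cnj ^^ \<epsilon> i) (indicator ?A (n + h i))) =
        of_real (shift_prod [] n) * (\<Prod>i=1..m. 1 / 2 + complex_of_real c * of_real (tm_sign (n + h i)))" for n
    proof -
      have "(cnj ^^ \<epsilon> i) (indicator ?A (n + h i)) = 1 / 2 + complex_of_real c * of_real (tm_sign (n + h i))"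
        if "i \<in> {1..m}" for i
      proof -
        have "cnj (indicator ?A (n + h i)) = indicator ?A (n + h i)"
          by (simp add: indicator_def)
        moreover have "\<epsilon> i = 0 \<or> \<epsilon> i = 1"
          using h that by blast
        ultimately have "(cnj ^^ \<epsilon> i) (indicator ?A (n + h i)) = indicator ?A (n + h i)"
          by (elim disjE) simp_all
        also have "\<dots> = 1 / 2 + complex_of_real c * of_real (tm_sign (n + h i))"
          using h that by (intro ind) (simp add: trans_le_add2)
        finally show ?thesis .
      qed
      then show ?thesis
        by simp
    qed
    then show "convergent (\<lambda>N. average (\<Phi> N) (\<lambda>n. \<Prod>i=1..m. (cnj ^^ \<epsilon> i) (indicator ?A (n + h i))))"
      using shift_prod_correlations[OF assms, of "[]" c h m] by simp
  qed
  with density norm show ?thesis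
    unfolding U_uniform_def by (intro conjI exI[of _ "1 / 2"]) simp_all
qed

theorem proposition6p4:
  fixes w :: "bit list" and k :: nat and \<Phi> :: "nat \<Rightarrow> nat set"
  assumes "w \<noteq> []"
    and "k \<ge> 1"
    and "prefix w ((tm_subst ^^ k) [0]) \<or> prefix w ((tm_subst ^^ k) [1])"
    and "folner \<Phi>"
  shows "U_infinity_uniform \<Phi> (quotient_set (occurrences w) (2 ^ k))"
proof -
  obtain a where "prefix w ((tm_subst ^^ k) [a])"
    using assms(3) by blast
  then have "quotient_set (occurrences w) (2 ^ k) = {n. 1 \<le> n \<and> thue_morse n = a}"
    by (rule quotient_set_occurrences[OF assms(1)])
  then show ?thesis
    unfolding U_infinity_uniform_def using thue_morse_class_uniform[OF assms(4)] by simp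
qed

end
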